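(* Let $q\ge 2$ and let $\{n_j\}_{j=0}^\infty$ be a sequence in $\mathbb{N}$ such that $n_0=1$ and $n_{j+1}/n_j\ge q$ for all $j\in\mathbb{Z}^+$. Let $\{\delta_j\}_{j\in\mathbb{Z}^+}\in\ell^2(\mathbb{Z}^+)$ be a sequence of complex numbers with $\|\{\delta_j\}\|_{\ell^\infty(\mathbb{Z}^+)}<1$. Let $\sigma$ be the probability measure on $\mathbb{T}$ (with infinite support) whose recurrence coefficients $\{\gamma_n(\sigma)\}_{n\ge0}$ satisfy $\gamma_{n_j}=\delta_j$ for all $j\in\mathbb{N}$ and $\gamma_n=0$ for all other $n\in\mathbb{Z}^+$. Then the limits $$\lim_{n\to\infty}\phi_n^*(z,\sigma)\quad\text{and}\quad\lim_{n\to\infty}\Phi_n^*(z,\sigma)$$ exist for (Lebesgue) a.e. $z\in\mathbb{T}$.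
   Context: $\mathbb{N}=\{1,2,\ldots\}$, $\mathbb{Z}^+=\{0,1,2,\ldots\}$, $\mathbb{T}$ is the unit circle, $\mathbb{D}$ the open unit disc. Let $\sigma$ be a probability measure on $\mathbb{T}$ whose support is an infinite set. Its monic orthogonal polynomials $\Phi_n(z,\sigma)$ and orthonormal polynomials $\phi_n(z,\sigma)$, $n\in\mathbb{Z}^+$, are determined by: $\deg\Phi_n=\deg\phi_n=n$; $\Phi_n$ has leading coefficient $1$ and $\phi_n$ has positive leading coefficient; $\int_{\mathbb{T}}\Phi_n(z,\sigma)z^{-j}d\sigma=\int_{\mathbb{T}}\phi_n(z,\sigma)z^{-j}d\sigma=0$ for all $j\in\{0,\ldots,n-1\}$; and $\int_{\mathbb{T}}|\phi_n|^2d\sigma=1$. For the polynomials of index $n$ one sets $\Phi_n^*(z):=z^n\overline{\Phi_n(\bar z^{-1})}$ and $\phi_n^*(z):=z^n\overline{\phi_n(\bar z^{-1})}$. The monic polynomials satisfy $$\Phi_{n+1}=z\Phi_n-\overline{\gamma_n}\,\Phi_n^*,\qquad \Phi_0=1,\quad n\in\mathbb{Z}^+,$$ where $\gamma_n=\gamma_n(\sigma)\in\mathbb{D}$ are called the recurrence (Schur, Verblunsky) coefficients of $\sigma$. The map $\sigma\mapsto\{\gamma_n\}_{n\ge0}$ is a bijection between probability measures on $\mathbb{T}$ with infinite support and sequences in $\mathbb{D}^\infty$. *)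

theory Defs
  imports "HOL-Probability.Probability" "HOL-Computational_Algebra.Polynomial"
begin

abbreviation unit_circle :: "complex set" where
  "unit_circle \<equiv> sphere 0 1"

definition circle_prob :: "complex measure \<Rightarrow> bool" where
  "circle_prob \<sigma> \<longleftrightarrow>
     prob_space \<sigma> \<and> sets \<sigma> = sets (restrict_space borel unit_circle)"

definition circle_support :: "complex measure \<Rightarrow> complex set" where
  "circle_support \<sigma> =
     {z \<in> unit_circle. \<forall>U. open U \<longrightarrow> z \<in> U \<longrightarrow> emeasure \<sigma> (U \<inter> unit_circle) > 0}"

text \<open>Arc length on the circle (total mass \<open>2 * pi\<close>).\<close>

definition arc_length :: "complex measure" where
  "arc_length = distr (restrict_space lborel {0..<2 * pi}) borel cis"

definition is_orthogonal_poly :: "complex measure \<Rightarrow> nat \<Rightarrow> complex poly \<Rightarrow> bool" where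
  "is_orthogonal_poly \<sigma> n p \<longleftrightarrow>
     degree p = n \<and> (\<forall>j<n. (LINT z|\<sigma>. poly p z * z powi (- int j)) = 0)"

definition monic_OP :: "complex measure \<Rightarrow> nat \<Rightarrow> complex poly" where
  "monic_OP \<sigma> n = (THE p. is_orthogonal_poly \<sigma> n p \<and> lead_coeff p = 1)"

definition orthonormal_OP :: "complex measure \<Rightarrow> nat \<Rightarrow> complex poly" where
  "orthonormal_OP \<sigma> n = (THE p. is_orthogonal_poly \<sigma> n p
     \<and> lead_coeff p \<in> \<real> \<and> Re (lead_coeff p) > 0
     \<and> (LINT z|\<sigma>. (cmod (poly p z))\<^sup>2) = 1)"

text \<open>Because \<open>inverse 0 = 0\<close>, this agrees with the reversed polynomial of index \<open>n\<close>
  only for \<open>z \<noteq> 0\<close>.\<close>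

definition star :: "nat \<Rightarrow> complex poly \<Rightarrow> complex \<Rightarrow> complex" where
  "star n p z = z ^ n * cnj (poly p (inverse (cnj z)))"

text \<open>Both sides of the recurrence are polynomials, so requiring it away from the origin
  is the same as requiring the polynomial identity.\<close>

definition recurrence_coeff :: "complex measure \<Rightarrow> nat \<Rightarrow> complex" where
  "recurrence_coeff \<sigma> n = (THE g. \<forall>z. z \<noteq> 0 \<longrightarrow>
     poly (monic_OP \<sigma> (Suc n)) z =
       z * poly (monic_OP \<sigma> n) z - cnj g * star n (monic_OP \<sigma> n) z)"

end

theory Submission
  imports Defs
begin

text \<open>On the circle the recurrence reads \<open>\<Phi>\<^sub>k\<^sub>+\<^sub>1\<^sup>* = \<Phi>\<^sub>k\<^sup>* - \<gamma>\<^sub>k z\<^sup>k\<^sup>+\<^sup>1 cnj \<Phi>\<^sub>k\<^sup>*\<close>, so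
  \<open>\<Phi>\<^sub>k\<^sup>*\<close> only changes at \<open>k = n\<^sub>j\<close>, where a reflected copy of its own spectrum is added. As the
  \<open>n\<^sub>j\<close> at least double, old and reflected spectra overlap in at most two frequencies, and the
  overlap involves the top coefficient, of size \<open>\<bar>\<delta>\<^sub>j\<bar>\<close>. Hence the norm in \<open>L\<^sup>2\<close> of Lebesgue
  measure stays bounded, and up to a uniformly vanishing error \<open>\<Phi>\<^sub>k\<^sup>*\<close> runs through the
  lacunary partial sums \<open>S\<^sub>n\<^sub>j\<close> of one fixed \<open>l\<^sup>2\<close> Fourier series. These converge almost everywhere by
  Kolmogorov's argument: with \<open>h\<^sub>j = 1 / n\<^sub>j\<close>, Parseval bounds the sum over \<open>j\<close> of the squared \<open>L\<^sup>2\<close>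
  distances between \<open>S\<^sub>n\<^sub>j\<close> and the means over \<open>[x, x + h\<^sub>j]\<close>, and the means converge by
  Lebesgue's differentiation theorem. The norming constants converge because
  \<open>\<parallel>\<Phi>\<^sub>k\<parallel>\<^sup>2\<close> is the product of the numbers \<open>1 - \<bar>\<gamma>\<^sub>i\<bar>\<^sup>2\<close>.\<close>

section \<open>Orthogonal polynomials on the unit circle\<close>

lemma unit_circle_cnj:
  assumes "cmod z = 1"
  shows "z * cnj z = 1"
  unfolding complex_norm_square[symmetric] assms by simp

lemma inverse_cnj_unit_circle:
  assumes "cmod z = 1"
  shows "inverse (cnj z) = z"
proof (rule inverse_unique)
  show "cnj z * z = 1" using unit_circle_cnj[OF assms] by (simp only: mult.commute)
qed

lemma unit_circle_power_cnj:
  assumes "cmod z = 1"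
  shows "z powi (- int j) = cnj (z ^ j)"
proof -
  have "inverse z = cnj z"
    using unit_circle_cnj[OF assms] by (rule inverse_unique)
  then show ?thesis
    unfolding power_int_minus power_int_of_nat complex_cnj_power power_inverse[symmetric] by simp
qed

text \<open>Inner products need a polynomial where \<open>star\<close> is only a function.
  \<open>reflect_poly\<close> reverses about the actual degree, so this matches
  \<open>star n p\<close> off the origin when \<open>degree p = n\<close>.\<close>

definition star_poly :: "complex poly \<Rightarrow> complex poly" where
  "star_poly p = map_poly cnj (reflect_poly p)"

lemma degree_star_poly_le: "degree (star_poly p) \<le> degree p"
  unfolding star_poly_def
  by (rule order_trans[OF map_poly_degree_leq degree_reflect_poly_le])

lemma poly_star_poly: "z \<noteq> 0 \<Longrightarrow> poly (star_poly p) z = star (degree p) p z"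
  by (simp add: star_poly_def star_def poly_reflect_poly_nz)

lemma star_unit_circle: "cmod z = 1 \<Longrightarrow> star n p z = z ^ n * cnj (poly p z)"
  by (simp only: star_def inverse_cnj_unit_circle)

locale circle_measure =
  fixes \<sigma> :: "complex measure"
  assumes prob: "circle_prob \<sigma>" and inf_support: "infinite (circle_support \<sigma>)"
begin

lemma prob_space: "prob_space \<sigma>"
  using prob by (simp add: circle_prob_def)

lemma sets_\<sigma>: "sets \<sigma> = sets (restrict_space borel unit_circle)"
  using prob by (simp add: circle_prob_def)

lemma space_\<sigma>: "space \<sigma> = unit_circle"
  using sets_eq_imp_space_eq[OF sets_\<sigma>] by (simp add: space_restrict_space)

lemma integrable_continuous:
  fixes f :: "complex \<Rightarrow> 'b :: {banach, second_countable_topology}"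
  assumes "continuous_on UNIV f"
  shows "integrable \<sigma> f"
proof -
  interpret prob_space \<sigma> by (rule prob_space)
  have "f \<in> borel_measurable (restrict_space borel unit_circle)"
    by (rule measurable_restrict_space1) (rule borel_measurable_continuous_onI[OF assms])
  then have meas: "f \<in> borel_measurable \<sigma>"
    using measurable_cong_sets[OF sets_\<sigma> refl] by blast
  have "compact (f ` unit_circle)"
    by (rule compact_continuous_image[OF continuous_on_subset[OF assms]]) auto
  then obtain C where "\<forall>x\<in>unit_circle. norm (f x) \<le> C"
    using compact_imp_bounded[of "f ` unit_circle"] unfolding bounded_iff by auto
  then have "AE x in \<sigma>. norm (f x) \<le> C"
    by (intro AE_I2) (simp add: space_\<sigma>)
  then show ?thesis using meas by (rule integrable_const_bound)
qed

section \<open>The inner product of \<sigma> on polynomials\<close>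

definition ip :: "complex poly \<Rightarrow> complex poly \<Rightarrow> complex" where
  "ip p q = (LINT z|\<sigma>. poly p z * cnj (poly q z))"

definition normsq :: "complex poly \<Rightarrow> real" where
  "normsq p = (LINT z|\<sigma>. (cmod (poly p z))\<^sup>2)"

lemma integrable_ip: "integrable \<sigma> (\<lambda>z. poly p z * cnj (poly q z))"
  by (rule integrable_continuous) (intro continuous_intros)

lemma integrable_normsq: "integrable \<sigma> (\<lambda>z. (cmod (poly p z))\<^sup>2)"
  by (rule integrable_continuous) (intro continuous_intros)

lemma ip_cong_circle:
  assumes "\<And>z. cmod z = 1 \<Longrightarrow> poly p z * cnj (poly q z) = poly p' z * cnj (poly q' z)"
  shows "ip p q = ip p' q'"
  unfolding ip_def
  by (rule Bochner_Integration.integral_cong) (use assms in \<open>simp_all add: space_\<sigma>\<close>)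

lemma ip_diff_left: "ip (p - p') q = ip p q - ip p' q"
  unfolding ip_def poly_diff left_diff_distrib
  by (rule Bochner_Integration.integral_diff) (rule integrable_ip)+

lemma ip_add_left: "ip (p + p') q = ip p q + ip p' q"
  unfolding ip_def poly_add distrib_right
  by (rule Bochner_Integration.integral_add) (rule integrable_ip)+

lemma ip_smult_left: "ip (smult a p) q = a * ip p q"
  unfolding ip_def poly_smult mult.assoc by (rule integral_mult_right_zero)

lemma ip_cnj: "ip q p = cnj (ip p q)"
  unfolding ip_def by (subst Bochner_Integration.integral_cnj[symmetric])
    (simp only: complex_cnj_mult complex_cnj_cnj mult.commute)

lemma ip_self: "ip p p = of_real (normsq p)"
  unfolding ip_def normsq_def by (simp only: complex_norm_square[symmetric] integral_complex_of_real)

lemma ip_expand: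
  assumes "degree q < n"
  shows "ip p q = (\<Sum>i<n. cnj (coeff q i) * ip p (monom 1 i))"
proof -
  have "poly q z = (\<Sum>i<n. coeff q i * z ^ i)" for z
    unfolding poly_altdef
    by (rule sum.mono_neutral_left) (use assms in \<open>auto simp: coeff_eq_0\<close>)
  then have "ip p q = (LINT z|\<sigma>. (\<Sum>i<n. cnj (coeff q i) * (poly p z * cnj (poly (monom 1 i) z))))"
    unfolding ip_def by (simp add: sum_distrib_left poly_monom mult_ac)
  also have "\<dots> = (\<Sum>i<n. cnj (coeff q i) * ip p (monom 1 i))"
    unfolding ip_def
    by (subst Bochner_Integration.integral_sum) (auto intro: integrable_ip)
  finally show ?thesis .
qed

text \<open>A polynomial vanishing almost everywhere vanishes on the whole support, because its
  nonvanishing set is open. An infinite support leaves too many roots. This makes \<open>ip\<close>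
  definite.\<close>

lemma normsq_eq_0:
  assumes "normsq p = 0"
  shows "p = 0"
proof (rule ccontr)
  assume "p \<noteq> 0"
  have "AE z in \<sigma>. (cmod (poly p z))\<^sup>2 = 0"
    using integral_nonneg_eq_0_iff_AE[OF integrable_normsq[of p]] assms by (simp add: normsq_def)
  then have AE: "AE z in \<sigma>. poly p z = 0" by simp
  have "poly p z = 0" if "z \<in> circle_support \<sigma>" for z
  proof (rule ccontr)
    assume "poly p z \<noteq> 0"
    define U where "U = {w. poly p w \<noteq> 0}"
    have "open U"
      unfolding U_def by (intro open_Collect_neq continuous_intros)
    then have "emeasure \<sigma> (U \<inter> unit_circle) > 0"
      using that \<open>poly p z \<noteq> 0\<close> by (auto simp: circle_support_def U_def)
    moreover have "U \<inter> unit_circle \<in> null_sets \<sigma>"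
    proof (subst AE_iff_null_sets)
      show "U \<inter> unit_circle \<in> sets \<sigma>"
        using \<open>open U\<close> unfolding sets_\<sigma> sets_restrict_space by (auto simp: Int_commute)
      show "AE z in \<sigma>. z \<notin> U \<inter> unit_circle"
        using AE by eventually_elim (simp add: U_def)
    qed
    ultimately show False by (simp add: null_setsD1)
  qed
  then have "circle_support \<sigma> \<subseteq> {z. poly p z = 0}" by auto
  then show False
    using poly_roots_finite[OF \<open>p \<noteq> 0\<close>] inf_support finite_subset by blast
qed

lemma normsq_nonneg: "0 \<le> normsq p"
  by (simp add: normsq_def)

lemma normsq_pos: "p \<noteq> 0 \<Longrightarrow> 0 < normsq p"
  using normsq_eq_0[of p] normsq_nonneg[of p] by linarith

section \<open>Monic orthogonal polynomials and the Szego recurrence\<close>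

lemma is_orthogonal_poly_iff:
  "is_orthogonal_poly \<sigma> n p \<longleftrightarrow> degree p = n \<and> (\<forall>j<n. ip p (monom 1 j) = 0)"
proof -
  have "(LINT z|\<sigma>. poly p z * z powi (- int j)) = ip p (monom 1 j)" for j
    unfolding ip_def
    by (rule Bochner_Integration.integral_cong) (simp_all add: space_\<sigma> unit_circle_power_cnj poly_monom)
  then show ?thesis by (simp add: is_orthogonal_poly_def)
qed

lemma orthogonal_to_lower_degree:
  assumes "is_orthogonal_poly \<sigma> n p" "degree q < n"
  shows "ip p q = 0"
  using assms by (simp add: ip_expand[OF assms(2)] is_orthogonal_poly_iff)

text \<open>The leading terms cancel in \<open>p - q\<close>, so both \<open>p\<close> and
  \<open>q\<close> are orthogonal to it, and it is orthogonal to itself.\<close>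

lemma monic_orthogonal_unique:
  assumes p: "is_orthogonal_poly \<sigma> n p" "lead_coeff p = 1"
    and q: "is_orthogonal_poly \<sigma> n q" "lead_coeff q = 1"
  shows "p = q"
proof (rule ccontr)
  assume "p \<noteq> q"
  have deg: "degree p = n" "degree q = n"
    using p q by (simp_all add: is_orthogonal_poly_iff)
  have "degree (p - q) \<le> n" using degree_diff_le[of p n q] deg by simp
  moreover have "coeff (p - q) n = 0" using deg p(2) q(2) by simp
  ultimately have lt: "degree (p - q) < n"
    using \<open>p \<noteq> q\<close> by (metis eq_iff_diff_eq_0 leading_coeff_neq_0 le_neq_implies_less)
  have "ip (p - q) (p - q) = 0"
    by (simp only: ip_diff_left[of p q] orthogonal_to_lower_degree[OF p(1) lt]
        orthogonal_to_lower_degree[OF q(1) lt] diff_self)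
  then have "normsq (p - q) = 0" by (simp add: ip_self)
  then show False using normsq_eq_0[of "p - q"] \<open>p \<noteq> q\<close> by simp
qed

text \<open>In the expansion of \<open>ip p p\<close>, all powers below \<open>n\<close> drop out by
  orthogonality and the top one has coefficient 1.\<close>

lemma ip_monic_monom:
  assumes "is_orthogonal_poly \<sigma> n p" "lead_coeff p = 1"
  shows "ip p (monom 1 n) = of_real (normsq p)"
proof -
  have deg: "degree p = n" using assms(1) by (simp add: is_orthogonal_poly_iff)
  have "ip p p = (\<Sum>i<Suc n. cnj (coeff p i) * ip p (monom 1 i))"
    using deg by (intro ip_expand) simp
  also have "\<dots> = ip p (monom 1 n)"
    using assms deg by (simp add: is_orthogonal_poly_iff)
  finally show ?thesis by (simp add: ip_self)
qed

text \<open>On the circle the reversed polynomial is \<open>z ^ n * cnj (poly p z)\<close>, so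
  reversal turns exponent \<open>j\<close> into \<open>n - j\<close>. For orthogonal
  \<open>p\<close>, the reversed polynomial is thus orthogonal to z, ..., z^n.\<close>

lemma ip_star_poly_monom:
  assumes "degree p = n" "j \<le> n"
  shows "ip (star_poly p) (monom 1 j) = cnj (ip p (monom 1 (n - j)))"
proof -
  have "ip (star_poly p) (monom 1 j) = ip (monom 1 (n - j)) p"
  proof (rule ip_cong_circle)
    fix z assume z: "cmod z = 1"
    then have "z \<noteq> 0" by auto
    have "z ^ n * cnj (z ^ j) = z ^ (n - j)"
    proof -
      have "z ^ n = z ^ (n - j) * z ^ j" using assms(2) by (simp flip: power_add)
      moreover have "z ^ j * cnj (z ^ j) = 1" using z by (intro unit_circle_cnj) (simp add: norm_power)
      ultimately show ?thesis by (simp add: mult.assoc)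
    qed
    moreover have "z ^ n * cnj (poly p z) * cnj (z ^ j) = z ^ n * cnj (z ^ j) * cnj (poly p z)"
      by (simp only: mult_ac)
    moreover have "poly (star_poly p) z = z ^ n * cnj (poly p z)"
      using poly_star_poly[OF \<open>z \<noteq> 0\<close>, of p] star_unit_circle[OF z] assms(1) by simp
    ultimately show "poly (star_poly p) z * cnj (poly (monom 1 j) z) = poly (monom 1 (n - j)) z * cnj (poly p z)"
      by (simp only: poly_monom mult_1)
  qed
  also have "\<dots> = cnj (ip p (monom 1 (n - j)))" by (rule ip_cnj)
  finally show ?thesis .
qed

lemma ip_shift: "ip (pCons 0 p) (pCons 0 q) = ip p q"
proof (rule ip_cong_circle)
  fix z assume "cmod z = 1"
  then have "(z * cnj z) * (poly p z * cnj (poly q z)) = poly p z * cnj (poly q z)"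
    by (simp only: unit_circle_cnj mult_1)
  then show "poly (pCons 0 p) z * cnj (poly (pCons 0 q) z) = poly p z * cnj (poly q z)"
    by (simp add: mult_ac)
qed

lemma normsq_shift: "normsq (pCons 0 p) = normsq p"
  using ip_shift[of p p] by (simp add: ip_self)

lemma normsq_star_poly: "normsq (star_poly p) = normsq p"
  unfolding normsq_def
proof (rule Bochner_Integration.integral_cong)
  fix z assume "z \<in> space \<sigma>"
  then have z: "cmod z = 1" by (simp add: space_\<sigma>)
  then have "z \<noteq> 0" by auto
  then show "(cmod (poly (star_poly p) z))\<^sup>2 = (cmod (poly p z))\<^sup>2"
    using z by (simp add: poly_star_poly star_unit_circle norm_mult norm_power)
qed simp

text \<open>Both z p and the reversed polynomial are orthogonal to z, ..., z^n. Only the constant 1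
  remains, and \<open>g\<close> is chosen to cancel that product, using that the reversed polynomial
  pairs with 1 to \<open>normsq p > 0\<close>.\<close>

lemma szego_step:
  assumes p: "is_orthogonal_poly \<sigma> n p" "lead_coeff p = 1"
  obtains g where "is_orthogonal_poly \<sigma> (Suc n) (pCons 0 p - smult (cnj g) (star_poly p))"
    "lead_coeff (pCons 0 p - smult (cnj g) (star_poly p)) = 1"
proof -
  have deg: "degree p = n" using p by (simp add: is_orthogonal_poly_iff)
  have "p \<noteq> 0" using p(2) by auto
  then have pos: "normsq p > 0" by (rule normsq_pos)
  define g where "g = cnj (ip (pCons 0 p) (monom 1 0) / of_real (normsq p))"
  define q where "q = pCons 0 p - smult (cnj g) (star_poly p)"
  have lt: "degree (smult (cnj g) (star_poly p)) < Suc n"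
    using degree_smult_le[of "cnj g" "star_poly p"] degree_star_poly_le[of p] deg by linarith
  have "degree (pCons 0 p) = Suc n" using \<open>p \<noteq> 0\<close> deg by simp
  then have "degree q \<le> Suc n" unfolding q_def using lt by (intro degree_diff_le) auto
  moreover have top: "coeff q (Suc n) = 1"
    unfolding q_def using p(2) deg lt by (simp add: coeff_eq_0 del: coeff_smult)
  ultimately have "degree q = Suc n" using le_degree[of q "Suc n"] by simp
  moreover have "ip q (monom 1 j) = 0" if "j < Suc n" for j
  proof (cases j)
    case 0
    have "ip (star_poly p) (monom 1 0) = of_real (normsq p)"
      using ip_star_poly_monom[OF deg, of 0] ip_monic_monom[OF p] by simp
    then show ?thesis
      unfolding q_def ip_diff_left ip_smult_left 0 g_def using pos by simp
  next
    case (Suc i)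
    have "ip (pCons 0 p) (monom 1 j) = ip p (monom 1 i)"
      using ip_shift[of p "monom 1 i"] by (simp only: Suc monom_Suc)
    moreover have "ip p (monom 1 i) = 0" "ip p (monom 1 (n - j)) = 0"
      using p(1) that Suc by (simp_all add: is_orthogonal_poly_iff)
    ultimately show ?thesis
      unfolding q_def ip_diff_left ip_smult_left
      using ip_star_poly_monom[OF deg, of j] that by simp
  qed
  ultimately show thesis
    using that[of g] top unfolding q_def[symmetric] by (simp add: is_orthogonal_poly_iff)
qed

lemma monic_orthogonal_exists: "\<exists>p. is_orthogonal_poly \<sigma> n p \<and> lead_coeff p = 1"
proof (induction n)
  case 0
  show ?case by (rule exI[of _ 1]) (simp add: is_orthogonal_poly_iff)
next
  case (Suc n)
  then show ?case using szego_step by metis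
qed

lemma monic_OP: "is_orthogonal_poly \<sigma> n (monic_OP \<sigma> n)" "lead_coeff (monic_OP \<sigma> n) = 1"
proof -
  have "\<exists>!p. is_orthogonal_poly \<sigma> n p \<and> lead_coeff p = 1"
    using monic_orthogonal_exists[of n] monic_orthogonal_unique by blast
  from theI'[OF this] show "is_orthogonal_poly \<sigma> n (monic_OP \<sigma> n)" "lead_coeff (monic_OP \<sigma> n) = 1"
    unfolding monic_OP_def by blast+
qed

lemma degree_monic_OP: "degree (monic_OP \<sigma> n) = n"
  using monic_OP(1) by (simp add: is_orthogonal_poly_iff)

lemma monic_OP_nonzero: "monic_OP \<sigma> n \<noteq> 0"
  using monic_OP(2)[of n] by auto

lemma monic_OP_0: "monic_OP \<sigma> 0 = 1"
  by (rule monic_orthogonal_unique[OF monic_OP]) (simp_all add: is_orthogonal_poly_iff)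

text \<open>At such a point \<open>star n\<close> is nonzero as well, so the recurrence there can be
  solved for its coefficient. This gives the uniqueness behind
  \<open>recurrence_coeff\<close>.\<close>

lemma monic_OP_nonzero_on_circle: "\<exists>z. cmod z = 1 \<and> poly (monic_OP \<sigma> n) z \<noteq> 0"
proof (rule ccontr)
  assume "\<not> ?thesis"
  then have "circle_support \<sigma> \<subseteq> {z. poly (monic_OP \<sigma> n) z = 0}"
    by (auto simp: circle_support_def)
  then show False
    using poly_roots_finite[OF monic_OP_nonzero] inf_support finite_subset by blast
qed

lemma szego_recurrence:
  "monic_OP \<sigma> (Suc n) = pCons 0 (monic_OP \<sigma> n) - smult (cnj (recurrence_coeff \<sigma> n)) (star_poly (monic_OP \<sigma> n))"
proof -
  let ?P = "monic_OP \<sigma> n"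
  obtain g where g: "is_orthogonal_poly \<sigma> (Suc n) (pCons 0 ?P - smult (cnj g) (star_poly ?P))"
    "lead_coeff (pCons 0 ?P - smult (cnj g) (star_poly ?P)) = 1"
    using szego_step[OF monic_OP] by blast
  have eq: "monic_OP \<sigma> (Suc n) = pCons 0 ?P - smult (cnj g) (star_poly ?P)"
    by (rule monic_orthogonal_unique[OF monic_OP g])
  have "recurrence_coeff \<sigma> n = g"
    unfolding recurrence_coeff_def
  proof (rule the_equality)
    show "\<forall>z. z \<noteq> 0 \<longrightarrow> poly (monic_OP \<sigma> (Suc n)) z = z * poly ?P z - cnj g * star n ?P z"
      by (simp add: eq poly_star_poly degree_monic_OP)
  next
    fix h assume h: "\<forall>z. z \<noteq> 0 \<longrightarrow> poly (monic_OP \<sigma> (Suc n)) z = z * poly ?P z - cnj h * star n ?P z"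
    obtain z where z: "cmod z = 1" "poly ?P z \<noteq> 0" using monic_OP_nonzero_on_circle by blast
    then have "z \<noteq> 0" by auto
    then have "star n ?P z \<noteq> 0" using z by (simp add: star_unit_circle)
    then show "h = g"
      using h[rule_format, OF \<open>z \<noteq> 0\<close>] \<open>z \<noteq> 0\<close> by (auto simp: eq poly_star_poly degree_monic_OP)
  qed
  then show ?thesis using eq by simp
qed

text \<open>Pythagoras: z \<Phi>_n is the sum of \<Phi>_(n+1) and a multiple of the reversed
  \<Phi>_n. The two are orthogonal since the latter has degree at most n, and neither shifting nor
  reversing changes the norm.\<close>

lemma normsq_monic_OP_Suc:
  "normsq (monic_OP \<sigma> (Suc n)) = (1 - (cmod (recurrence_coeff \<sigma> n))\<^sup>2) * normsq (monic_OP \<sigma> n)"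
proof -
  define P Q R a where "P = monic_OP \<sigma> n" and "Q = monic_OP \<sigma> (Suc n)" and "R = star_poly P"
    and "a = cnj (recurrence_coeff \<sigma> n)"
  have shift: "pCons 0 P = Q + smult a R"
    using szego_recurrence[of n] by (simp add: P_def Q_def R_def a_def)
  have QR: "ip Q R = 0"
    unfolding Q_def using degree_star_poly_le[of P]
    by (intro orthogonal_to_lower_degree[OF monic_OP(1)]) (simp add: R_def P_def degree_monic_OP)
  then have RQ: "ip R Q = 0" using ip_cnj[of R Q] by simp
  have right: "ip p (smult a R) = cnj a * ip p R" for p
    using ip_cnj[of p "smult a R"] ip_cnj[of R p] by (simp add: ip_smult_left)
  have "ip (pCons 0 P) (pCons 0 P) = ip Q (Q + smult a R) + a * ip R (Q + smult a R)"
    unfolding shift ip_add_left[of Q] ip_smult_left ..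
  also have "\<dots> = cnj (ip (Q + smult a R) Q) + a * cnj (ip (Q + smult a R) R)"
    by (simp only: ip_cnj[of Q] ip_cnj[of R])
  also have "\<dots> = cnj (ip Q Q) + a * cnj a * cnj (ip R R)"
    by (simp add: ip_add_left ip_smult_left QR RQ)
  also have "\<dots> = of_real (normsq Q + (cmod a)\<^sup>2 * normsq P)"
    unfolding ip_self complex_norm_square[symmetric] R_def normsq_star_poly by simp
  finally have "normsq (pCons 0 P) = normsq Q + (cmod a)\<^sup>2 * normsq P"
    unfolding ip_self of_real_eq_iff .
  then show ?thesis
    by (simp add: normsq_shift P_def Q_def a_def algebra_simps)
qed

section \<open>Norming constants and reversed polynomials on the circle\<close>

lemma normsq_smult: "normsq (smult a p) = (cmod a)\<^sup>2 * normsq p"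
  by (simp add: normsq_def norm_mult power_mult_distrib)

lemma is_orthogonal_poly_smult:
  "a \<noteq> 0 \<Longrightarrow> is_orthogonal_poly \<sigma> n p \<Longrightarrow> is_orthogonal_poly \<sigma> n (smult a p)"
  by (simp add: is_orthogonal_poly_iff ip_smult_left)

lemma orthonormal_OP_eq:
  "orthonormal_OP \<sigma> n = smult (of_real (1 / sqrt (normsq (monic_OP \<sigma> n)))) (monic_OP \<sigma> n)"
  unfolding orthonormal_OP_def
proof (rule the_equality)
  let ?P = "monic_OP \<sigma> n"
  have pos: "0 < normsq ?P" by (rule normsq_pos[OF monic_OP_nonzero])
  show "is_orthogonal_poly \<sigma> n (smult (of_real (1 / sqrt (normsq ?P))) ?P)
      \<and> lead_coeff (smult (of_real (1 / sqrt (normsq ?P))) ?P) \<in> \<real>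
      \<and> 0 < Re (lead_coeff (smult (of_real (1 / sqrt (normsq ?P))) ?P))
      \<and> (LINT z|\<sigma>. (cmod (poly (smult (of_real (1 / sqrt (normsq ?P))) ?P) z))\<^sup>2) = 1"
  proof (intro conjI)
    show "is_orthogonal_poly \<sigma> n (smult (of_real (1 / sqrt (normsq ?P))) ?P)"
      using pos by (intro is_orthogonal_poly_smult monic_OP(1)) simp
    have lead: "lead_coeff (smult (of_real (1 / sqrt (normsq ?P))) ?P) = of_real (1 / sqrt (normsq ?P))"
      using monic_OP(2)[of n] by (simp only: lead_coeff_smult mult_1_right)
    show "lead_coeff (smult (of_real (1 / sqrt (normsq ?P))) ?P) \<in> \<real>"
      unfolding lead by (rule Reals_of_real)
    show "0 < Re (lead_coeff (smult (of_real (1 / sqrt (normsq ?P))) ?P))"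
      unfolding lead Re_complex_of_real using pos by simp
    have "normsq (smult (of_real (1 / sqrt (normsq ?P))) ?P) = (1 / sqrt (normsq ?P))\<^sup>2 * normsq ?P"
      unfolding normsq_smult norm_of_real power2_abs ..
    also have "\<dots> = 1" using pos by (simp add: power_divide)
    finally show "(LINT z|\<sigma>. (cmod (poly (smult (of_real (1 / sqrt (normsq ?P))) ?P) z))\<^sup>2) = 1"
      by (simp only: normsq_def)
  qed
  fix q assume q: "is_orthogonal_poly \<sigma> n q \<and> lead_coeff q \<in> \<real> \<and> 0 < Re (lead_coeff q)
      \<and> (LINT z|\<sigma>. (cmod (poly q z))\<^sup>2) = 1"
  define a where "a = Re (lead_coeff q)"
  have lead: "lead_coeff q = of_real a" using q by (simp add: a_def complex_is_Real_iff complex_eq_iff)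
  have "0 < a" using q by (simp add: a_def)
  \<comment> \<open>Dividing a competitor by its positive leading coefficient \<open>a\<close> gives
    the monic polynomial; the unit norm then determines \<open>a\<close>.\<close>
  have "smult (of_real (1 / a)) q = ?P"
    using q \<open>0 < a\<close> monic_OP
    by (intro monic_orthogonal_unique[of n] is_orthogonal_poly_smult) (simp_all only: lead_coeff_smult lead, simp_all)
  then have "smult (of_real a) (smult (of_real (1 / a)) q) = smult (of_real a) ?P" by simp
  then have q_eq: "q = smult (of_real a) ?P" using \<open>0 < a\<close> by simp
  have "1 = normsq q" using q by (simp add: normsq_def)
  also have "\<dots> = a\<^sup>2 * normsq ?P" unfolding q_eq normsq_smult norm_of_real power2_abs ..
  finally have "a\<^sup>2 = (1 / sqrt (normsq ?P))\<^sup>2" using pos by (simp add: power_divide field_simps)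
  then have "a = 1 / sqrt (normsq ?P)"
    using \<open>0 < a\<close> pos by (simp add: power2_eq_iff_nonneg)
  then show "q = smult (of_real (1 / sqrt (normsq ?P))) ?P" using q_eq by simp
qed

lemma star_orthonormal_OP:
  "star n (orthonormal_OP \<sigma> n) z = of_real (1 / sqrt (normsq (monic_OP \<sigma> n))) * star n (monic_OP \<sigma> n) z"
  unfolding orthonormal_OP_eq star_def poly_smult complex_cnj_mult complex_cnj_complex_of_real by (rule mult.left_commute)

text \<open>Conjugating the Szego recurrence and multiplying by \<open>z ^ Suc n\<close> leaves only
  reversed polynomials, because \<open>z * cnj z = 1\<close>. The recurrence thereby closes up on
  the circle.\<close>

lemma star_monic_OP_Suc:
  assumes "cmod z = 1"
  shows "star (Suc n) (monic_OP \<sigma> (Suc n)) z = star n (monic_OP \<sigma> n) z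
    - recurrence_coeff \<sigma> n * z ^ Suc n * cnj (star n (monic_OP \<sigma> n) z)"
proof -
  have "z \<noteq> 0" using assms by auto
  have eq: "z ^ Suc n * cnj z = z ^ n"
    using unit_circle_cnj[OF assms] by (simp add: mult.commute mult.left_commute)
  have "star (Suc n) (monic_OP \<sigma> (Suc n)) z
      = z ^ Suc n * cnj (z * poly (monic_OP \<sigma> n) z - cnj (recurrence_coeff \<sigma> n) * star n (monic_OP \<sigma> n) z)"
    unfolding star_unit_circle[OF assms, of "Suc n"] szego_recurrence[of n]
    using \<open>z \<noteq> 0\<close> by (simp add: poly_star_poly degree_monic_OP)
  also have "\<dots> = (z ^ Suc n * cnj z) * cnj (poly (monic_OP \<sigma> n) z)
      - recurrence_coeff \<sigma> n * z ^ Suc n * cnj (star n (monic_OP \<sigma> n) z)"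
    unfolding complex_cnj_diff complex_cnj_mult complex_cnj_cnj right_diff_distrib by (simp only: mult_ac)
  finally show ?thesis
    unfolding eq star_unit_circle[OF assms, of n, symmetric] .
qed

end

section \<open>Trigonometric polynomials\<close>

definition trig_poly :: "(nat \<Rightarrow> complex) \<Rightarrow> nat \<Rightarrow> real \<Rightarrow> complex" where
  "trig_poly a N x = (\<Sum>k\<le>N. a k * cis (real k * x))"

text \<open>Two periods, so that \<open>{x..x + h}\<close> stays inside for \<open>x \<in> {0..2 * pi}\<close> and small \<open>h\<close>.\<close>

definition window :: "real measure" where
  "window = restrict_space lborel {0..4 * pi}"

lemma space_window [simp]: "space window = {0..4 * pi}"
  by (simp add: window_def space_restrict_space)

lemma finite_measure_window: "finite_measure window"
  by (rule finite_measureI) (simp add: window_def emeasure_restrict_space)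

lemma integral_window_const:
  fixes c :: real
  shows "integrable window (\<lambda>_. c)" and "(LINT x|window. c) = 4 * pi * c"
  using finite_measure.integrable_const[OF finite_measure_window]
  by (simp_all add: measure_def window_def emeasure_restrict_space)

lemma borel_measurable_window:
  "f \<in> borel_measurable borel \<Longrightarrow> f \<in> borel_measurable window"
  unfolding window_def by (rule measurable_restrict_space1) simp

lemma cis_conv_exp_of_real: "cis (real k * x) = exp (\<i> * of_nat k * of_real x)"
  by (simp only: cis_conv_exp of_real_mult of_real_of_nat_eq mult.assoc)

lemma trig_poly_measurable [measurable]: "trig_poly a N \<in> borel_measurable borel"
  unfolding trig_poly_def cis_conv_exp_of_real
  by (intro borel_measurable_continuous_onI continuous_intros)

lemma norm_trig_poly_le: "cmod (trig_poly a N x) \<le> (\<Sum>k\<le>N. cmod (a k))"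
  unfolding trig_poly_def by (rule order_trans[OF norm_sum]) (simp add: norm_mult)

section \<open>Orthogonality of exponentials and Parseval's identity\<close>

lemma integral_cis:
  assumes "a \<le> b" "t \<noteq> 0"
  shows "((\<lambda>x. cis (t * x)) has_integral (cis (t * b) - cis (t * a)) / (\<i> * t)) {a..b}"
proof -
  have "((\<lambda>x. cis (t * x)) has_integral (cis (t * b) / (\<i> * t) - cis (t * a) / (\<i> * t))) {a..b}"
  proof (rule fundamental_theorem_of_calculus[OF \<open>a \<le> b\<close>])
    fix x
    define c :: complex where "c = \<i> * of_real t"
    have "c \<noteq> 0" using \<open>t \<noteq> 0\<close> by (simp add: c_def)
    have cis: "cis (t * x) = exp (c * of_real x)" for x
      by (simp only: cis_conv_exp c_def of_real_mult mult.assoc)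
    have "((\<lambda>x. exp (c * x) / c) has_field_derivative exp (c * of_real x)) (at (of_real x :: complex))"
      by (rule derivative_eq_intros refl | simp add: \<open>c \<noteq> 0\<close>)+
    then have "((\<lambda>x. exp (c * of_real x) / c) has_vector_derivative exp (c * of_real x)) (at x)"
      by (rule has_vector_derivative_real_field)
    then show "((\<lambda>x. cis (t * x) / (\<i> * t)) has_vector_derivative cis (t * x)) (at x within {a..b})"
      unfolding cis c_def[symmetric] by (rule has_vector_derivative_at_within)
  qed
  then show ?thesis by (simp add: diff_divide_distrib)
qed

lemma integral_window_cis:
  fixes j :: int
  shows "integrable window (\<lambda>x. cis (of_int j * x))"
    and "(LINT x|window. cis (of_int j * x)) = (if j = 0 then of_real (4 * pi) else 0)"
proof -
  have cont: "continuous_on S (\<lambda>x. cis (of_int j * x))" for S :: "real set"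
    unfolding cis_conv_exp by (intro continuous_intros)
  have meas: "(\<lambda>x. cis (of_int j * x)) \<in> borel_measurable borel"
    using cont by (rule borel_measurable_continuous_onI)
  show int: "integrable window (\<lambda>x. cis (of_int j * x))"
    by (rule finite_measure.integrable_const_bound[OF finite_measure_window, where B = 1])
      (use borel_measurable_window[OF meas] in auto)
  have "(LINT x|window. cis (of_int j * x)) = (LINT x:{0..4*pi}|lborel. cis (of_int j * x))"
    unfolding window_def set_lebesgue_integral_def by (rule integral_restrict_space) simp
  also have "\<dots> = integral {0..4*pi} (\<lambda>x. cis (of_int j * x))"
    by (rule set_borel_integral_eq_integral(2))
      (use int in \<open>simp add: window_def set_integrable_def integrable_restrict_space\<close>)
  also have "\<dots> = (if j = 0 then of_real (4 * pi) else 0)"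
  proof (cases "j = 0")
    case False
    have "((\<lambda>x. cis (of_int j * x)) has_integral (cis (of_int j * (4*pi)) - cis (of_int j * 0)) / (\<i> * of_int j)) {0..4*pi}"
      using integral_cis[of 0 "4*pi" "of_int j"] False by (simp only: of_int_eq_0_iff of_real_of_int_eq) simp
    moreover have "cis (of_int j * (4*pi)) = 1"
    proof -
      have "of_int j * (4*pi) = 2 * pi * of_int (2 * j)" by simp
      then show ?thesis by (simp only: cis_multiple_2pi Ints_of_int)
    qed
    ultimately show ?thesis using False by (simp add: integral_unique)
  qed (simp add: scaleR_conv_of_real)
  finally show "(LINT x|window. cis (of_int j * x)) = (if j = 0 then of_real (4 * pi) else 0)" .
qed

lemma cis_mult_cnj_cis: "cis s * cnj (cis t) = cis (s - t)"
  by (simp only: cis_cnj cis_mult diff_conv_add_uminus)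

lemma integrable_trig_poly: "integrable window (trig_poly a N)"
  by (rule finite_measure.integrable_const_bound[OF finite_measure_window])
    (rule AE_I2, rule norm_trig_poly_le, rule borel_measurable_window, rule trig_poly_measurable)

lemma parseval_trig_poly:
  shows "integrable window (\<lambda>x. (cmod (trig_poly a N x))\<^sup>2)"
    and "(LINT x|window. (cmod (trig_poly a N x))\<^sup>2) = 4 * pi * (\<Sum>k\<le>N. (cmod (a k))\<^sup>2)"
proof -
  have expand: "complex_of_real ((cmod (trig_poly a N x))\<^sup>2)
      = (\<Sum>k\<le>N. \<Sum>l\<le>N. a k * cnj (a l) * cis (of_int (int k - int l) * x))" for x
  proof -
    have "real k * x - real l * x = of_int (int k - int l) * x" for k l
      by (simp add: left_diff_distrib)
    then have eq: "cis (of_int (int k - int l) * x) = cis (real k * x) * cnj (cis (real l * x))" for k l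
      by (simp only: cis_mult_cnj_cis)
    have *: "a k * cnj (a l) * cis (of_int (int k - int l) * x)
        = a k * cis (real k * x) * cnj (a l * cis (real l * x))" for k l
      unfolding eq by (simp only: complex_cnj_mult mult_ac)
    show ?thesis
      unfolding * trig_poly_def complex_norm_square cnj_sum sum_product ..
  qed
  have "complex_of_real (LINT x|window. (cmod (trig_poly a N x))\<^sup>2)
      = (LINT x|window. (\<Sum>k\<le>N. \<Sum>l\<le>N. a k * cnj (a l) * cis (of_int (int k - int l) * x)))"
    by (simp only: expand flip: integral_complex_of_real)
  also have "\<dots> = (\<Sum>k\<le>N. \<Sum>l\<le>N. a k * cnj (a l) * (if int k - int l = 0 then of_real (4 * pi) else 0))"
    by (simp only: Bochner_Integration.integral_sum Bochner_Integration.integrable_sum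
        integrable_mult_right integral_window_cis integral_mult_right_zero)
  also have "\<dots> = (\<Sum>k\<le>N. \<Sum>l\<le>N. if k = l then a k * cnj (a l) * of_real (4 * pi) else 0)"
    by (intro sum.cong) auto
  also have "\<dots> = (\<Sum>k\<le>N. a k * cnj (a k) * of_real (4 * pi))"
    by (intro sum.cong refl) (simp add: sum.delta)
  also have "\<dots> = complex_of_real (4 * pi * (\<Sum>k\<le>N. (cmod (a k))\<^sup>2))"
    by (simp add: sum_distrib_left complex_norm_square mult.commute del: of_real_power)
  finally show "(LINT x|window. (cmod (trig_poly a N x))\<^sup>2) = 4 * pi * (\<Sum>k\<le>N. (cmod (a k))\<^sup>2)"
    using of_real_eq_iff by blast
  show "integrable window (\<lambda>x. (cmod (trig_poly a N x))\<^sup>2)"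
  proof (rule finite_measure.integrable_const_bound[OF finite_measure_window])
    show "AE x in window. norm ((cmod (trig_poly a N x))\<^sup>2) \<le> (\<Sum>k\<le>N. cmod (a k))\<^sup>2"
      by (rule AE_I2) (simp add: power_mono norm_trig_poly_le)
    show "(\<lambda>x. (cmod (trig_poly a N x))\<^sup>2) \<in> borel_measurable window"
      by (rule borel_measurable_window) measurable
  qed
qed

lemma nn_integral_trig_poly:
  "(\<integral>\<^sup>+x. ennreal ((cmod (trig_poly a N x))\<^sup>2) \<partial>window) = ennreal (4 * pi * (\<Sum>k\<le>N. (cmod (a k))\<^sup>2))"
  by (subst nn_integral_eq_integral[OF parseval_trig_poly(1)]) (simp_all add: parseval_trig_poly(2))

lemma set_integral_window:
  fixes g :: "real \<Rightarrow> complex"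
  assumes g: "integrable window g" and ab: "{a..b} \<subseteq> {0..4 * pi}"
  shows "g integrable_on {a..b}" and "(LINT y:{a..b}|window. g y) = integral {a..b} g"
proof -
  have "integrable lborel (\<lambda>x. indicator {0..4 * pi} x *\<^sub>R g x)"
    using g by (simp add: window_def integrable_restrict_space)
  then have "set_integrable lborel {0..4 * pi} g"
    by (simp add: set_integrable_def)
  then have int: "set_integrable lborel {a..b} g"
    by (rule set_integrable_subset) (use ab in auto)
  show "g integrable_on {a..b}"
    using int by (rule set_borel_integral_eq_integral)
  have "(LINT y:{a..b}|window. g y) = (LINT y|lborel. indicator {0..4 * pi} y *\<^sub>R (indicator {a..b} y *\<^sub>R g y))"
    unfolding set_lebesgue_integral_def window_def by (rule integral_restrict_space) simp
  also have "\<dots> = (LINT y:{a..b}|lborel. g y)"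
    unfolding set_lebesgue_integral_def
    by (rule Bochner_Integration.integral_cong) (use ab in \<open>auto simp: indicator_def\<close>)
  also have "\<dots> = integral {a..b} g"
    using int by (rule set_borel_integral_eq_integral)
  finally show "(LINT y:{a..b}|window. g y) = integral {a..b} g" .
qed

text \<open>Averaging over \<open>{x..x + h}\<close> multiplies the \<open>k\<close>-th Fourier coefficient by this number.\<close>

definition mean_multiplier :: "real \<Rightarrow> nat \<Rightarrow> complex" where
  "mean_multiplier h k = (if k = 0 then 1 else (cis (real k * h) - 1) / (\<i> * of_real (real k * h)))"

lemma has_integral_cis_mean:
  assumes "0 < h"
  shows "((\<lambda>y. cis (real k * y)) has_integral of_real h * mean_multiplier h k * cis (real k * x)) {x..x + h}"
proof (cases "k = 0")
  case True
  then show ?thesis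
    using has_integral_const_real[of "1 :: complex" x "x + h"] assms
    by (simp add: mean_multiplier_def scaleR_conv_of_real)
next
  case False
  have "cis (real k * (x + h)) = cis (real k * h) * cis (real k * x)"
    unfolding cis_mult by (simp add: algebra_simps)
  then have "(cis (real k * (x + h)) - cis (real k * x)) / (\<i> * of_real (real k))
      = of_real h * mean_multiplier h k * cis (real k * x)"
    using False assms by (simp only: mean_multiplier_def if_False) (simp add: field_simps)
  then show ?thesis
    using integral_cis[of x "x + h" "real k"] False assms by simp
qed

lemma integral_trig_poly_mean:
  assumes "0 < h"
  shows "integral {x..x + h} (trig_poly a N) = of_real h * trig_poly (\<lambda>k. mean_multiplier h k * a k) N x"
proof -
  have "((\<lambda>y. \<Sum>k\<le>N. a k * cis (real k * y)) has_integral
      (\<Sum>k\<le>N. a k * (of_real h * mean_multiplier h k * cis (real k * x)))) {x..x + h}"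
    by (intro has_integral_sum has_integral_mult_right has_integral_cis_mean assms) simp
  moreover have "(\<lambda>y. \<Sum>k\<le>N. a k * cis (real k * y)) = trig_poly a N"
    by (simp add: trig_poly_def fun_eq_iff)
  moreover have "(\<Sum>k\<le>N. a k * (of_real h * mean_multiplier h k * cis (real k * x)))
      = of_real h * trig_poly (\<lambda>k. mean_multiplier h k * a k) N x"
    by (simp add: trig_poly_def sum_distrib_left mult_ac)
  ultimately show ?thesis by (simp only: integral_unique)
qed

section \<open>Size of the averaging multipliers along a lacunary sequence\<close>

lemma norm_mean_multiplier_le:
  assumes "0 < h" "0 < k"
  shows "cmod (mean_multiplier h k) \<le> 2 / (real k * h)"
proof -
  have "cmod (cis (real k * h) - 1) \<le> 2"
    by (rule order_trans[OF norm_triangle_ineq4]) simp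
  then show ?thesis
    using assms by (simp add: mean_multiplier_def norm_divide norm_mult divide_right_mono)
qed

text \<open>With \<open>t = real k * h\<close>, the difference is the remainder of the first-order
  Taylor expansion of the exponential divided by \<open>t\<close>, and that remainder is at most
  \<open>t\<^sup>2\<close>.\<close>

lemma norm_one_minus_mean_multiplier_le:
  assumes "0 < h"
  shows "cmod (1 - mean_multiplier h k) \<le> real k * h"
proof (cases "k = 0")
  case False
  define t where "t = real k * h"
  have t: "0 < t" using assms False by (simp add: t_def)
  have "cmod (iexp t - (1 + \<i> * of_real t)) \<le> \<bar>t\<bar>\<^sup>2 / fact 2"
    using iexp_approx1[of t 1] by (simp add: power2_eq_square)
  then have *: "cmod (cis t - (1 + \<i> * of_real t)) \<le> t\<^sup>2"
    using norm_ge_zero[of "iexp t - (1 + \<i> * of_real t)"] unfolding cis_conv_exp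
    by (simp only: fact_2 power2_abs)
  have "1 - mean_multiplier h k = - ((cis t - (1 + \<i> * of_real t)) / (\<i> * of_real t))"
    using False t by (simp only: mean_multiplier_def t_def[symmetric] if_False) (simp add: field_simps)
  then have "cmod (1 - mean_multiplier h k) = cmod (cis t - (1 + \<i> * of_real t)) / t"
    using t by (simp add: norm_divide norm_mult)
  also have "\<dots> \<le> t\<^sup>2 / t"
    using * t by (intro divide_right_mono) auto
  also have "\<dots> = real k * h"
    using t by (simp only: power2_eq_square t_def[symmetric]) simp
  finally show ?thesis .
qed (simp add: mean_multiplier_def)

text \<open>Doubling makes all terms before \<open>n j\<close> add up to at most \<open>n j\<close>,
  so the last term below \<open>k\<close> controls the sum up to a factor 2.\<close>

lemma lacunary_sum_below:
  fixes n :: "nat \<Rightarrow> nat"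
  assumes lac: "\<And>i. 2 * n i \<le> n (Suc i)"
  shows "(\<Sum>i<I. if n i < k then real (n i) else 0) \<le> 2 * real k"
proof (induction I)
  case (Suc I)
  have sum: "(\<Sum>i<j. real (n i)) \<le> real (n j)" for j
  proof (induction j)
    case (Suc j)
    then show ?case using lac[of j] by simp
  qed simp
  show ?case
  proof (cases "n I < k")
    case True
    have "(\<Sum>i<Suc I. if n i < k then real (n i) else 0) \<le> (\<Sum>i<Suc I. real (n i))"
      by (rule sum_mono) simp
    also have "\<dots> \<le> 2 * real (n I)" using sum[of I] by simp
    finally show ?thesis using True by simp
  qed (use Suc in simp)
qed simp

lemma lacunary_sum_above:
  fixes n :: "nat \<Rightarrow> nat"
  assumes lac: "\<And>i. 2 * n i \<le> n (Suc i)" and pos: "\<And>i. 0 < n i" and "0 < k"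
  shows "(\<Sum>i<I. if k \<le> n i then 1 / real (n i) else 0) \<le> 2 / real k"
proof -
  \<comment> \<open>The subtracted \<open>2 / real (n I)\<close> lets the induction close: doubling
    gives \<open>1 / n I \<le> 2 / n I - 2 / n (Suc I)\<close>, so the bound telescopes.\<close>
  have "(\<Sum>i<I. if k \<le> n i then 1 / real (n i) else 0)
      \<le> (if k \<le> n I then 2 / real k - 2 / real (n I) else 0)"
  proof (induction I)
    case (Suc I)
    have dbl: "2 / real (n (Suc I)) \<le> 1 / real (n I)"
      using lac[of I] pos[of I] pos[of "Suc I"] by (simp add: field_simps)
    have "k \<le> n (Suc I)" if "k \<le> n I" using that lac[of I] by linarith
    moreover have "2 / real (n (Suc I)) \<le> 2 / real k" if "k \<le> n (Suc I)"
      using that \<open>0 < k\<close> by (intro divide_left_mono) (auto intro!: mult_pos_pos)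
    moreover have "2 / real (n I) = 1 / real (n I) + 1 / real (n I)" by simp
    ultimately show ?case using Suc dbl by (auto split: if_splits)
  qed (use \<open>0 < k\<close> pos[of 0] in \<open>auto intro!: divide_left_mono\<close>)
  also have "\<dots> \<le> 2 / real k" by simp
  finally show ?thesis .
qed

text \<open>The difference is the Fourier multiplier of partial sum minus mean. It is small when
  \<open>k\<close> is far below \<open>n i\<close> (short intervals see a slow oscillation) and when
  \<open>k\<close> is far above (averaging damps a fast one). A bound uniform in \<open>k\<close> is
  what Parseval needs.\<close>

lemma lacunary_multiplier_sum:
  fixes n :: "nat \<Rightarrow> nat"
  assumes lac: "\<And>i. 2 * n i \<le> n (Suc i)" and pos: "\<And>i. 0 < n i"
  shows "(\<Sum>i<I. (cmod ((if k \<le> n i then 1 else 0) - mean_multiplier (1 / real (n i)) k))\<^sup>2) \<le> 10"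
proof (cases "k = 0")
  case False
  then have k: "0 < real k" by simp
  have bound: "(cmod ((if k \<le> n i then 1 else 0) - mean_multiplier (1 / real (n i)) k))\<^sup>2
      \<le> real k * (if k \<le> n i then 1 / real (n i) else 0) + 4 / real k * (if n i < k then real (n i) else 0)" for i
  proof -
    have h: "0 < 1 / real (n i)" using pos[of i] by simp
    \<comment> \<open>In each case the relevant ratio of \<open>k\<close> and \<open>n i\<close> is
      at most 1, so its square may be replaced by the ratio itself, which the two lacunary sums
      control.\<close>
    have sq: "t\<^sup>2 \<le> t" if "0 \<le> t" "t \<le> 1" for t :: real
      using that by (simp add: power2_eq_square mult_left_le)
    show ?thesis
    proof (cases "k \<le> n i")
      case True
      have "(cmod (1 - mean_multiplier (1 / real (n i)) k))\<^sup>2 \<le> (real k / real (n i))\<^sup>2"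
        using norm_one_minus_mean_multiplier_le[OF h, of k] by (intro power_mono) auto
      also have "\<dots> \<le> real k / real (n i)"
        using True pos[of i] by (intro sq) auto
      finally show ?thesis using True by simp
    next
      case False
      have "(cmod (mean_multiplier (1 / real (n i)) k))\<^sup>2 \<le> (2 * (real (n i) / real k))\<^sup>2"
        using norm_mean_multiplier_le[OF h, of k] \<open>k \<noteq> 0\<close> by (intro power_mono) auto
      also have "\<dots> = 4 * (real (n i) / real k)\<^sup>2" by (simp only: power_mult_distrib) simp
      also have "\<dots> \<le> 4 * (real (n i) / real k)"
        using False by (intro mult_left_mono sq) auto
      finally show ?thesis using False by simp
    qed
  qed
  have "(\<Sum>i<I. (cmod ((if k \<le> n i then 1 else 0) - mean_multiplier (1 / real (n i)) k))\<^sup>2)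
      \<le> real k * (\<Sum>i<I. if k \<le> n i then 1 / real (n i) else 0)
        + 4 / real k * (\<Sum>i<I. if n i < k then real (n i) else 0)"
    unfolding sum_distrib_left sum.distrib[symmetric] by (rule sum_mono) (rule bound)
  \<comment> \<open>Frequencies with \<open>k \<le> n i\<close> contribute 2 and the others 8,
    whence the constant 10.\<close>
  also have "\<dots> \<le> real k * (2 / real k) + 4 / real k * (2 * real k)"
    using k lacunary_sum_below[of n, OF lac] lacunary_sum_above[of n, OF lac pos, of k]
    by (intro add_mono mult_left_mono) auto
  finally show ?thesis using k by simp
qed (simp add: mean_multiplier_def)

section \<open>Lacunary partial sums of Fourier series\<close>

text \<open>Summable L1 norms of the increments make the telescoping series converge absolutely
  almost everywhere. The conclusion is phrased by integrals over sets because the limit is later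
  used only through its interval means.\<close>

lemma L1_limit_of_summable_increments:
  fixes g :: "nat \<Rightarrow> 'a \<Rightarrow> 'b::{banach,second_countable_topology}"
  assumes g: "\<And>m. integrable M (g m)"
    and sm: "summable (\<lambda>m. LINT x|M. norm (g (Suc m) x - g m x))"
  obtains f where "integrable M f"
    "\<And>A. A \<in> sets M \<Longrightarrow> (\<lambda>m. LINT x:A|M. g m x) \<longlonglongrightarrow> (LINT x:A|M. f x)"
proof -
  define u where "u m x = g (Suc m) x - g m x" for m x
  have u: "integrable M (u m)" for m
    unfolding u_def using g by auto
  have "(\<integral>\<^sup>+x. (\<Sum>m. ennreal (norm (u m x))) \<partial>M) = (\<Sum>m. \<integral>\<^sup>+x. ennreal (norm (u m x)) \<partial>M)"
    using u by (intro nn_integral_suminf) auto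
  also have "\<dots> = (\<Sum>m. ennreal (LINT x|M. norm (u m x)))"
    using u by (subst nn_integral_eq_integral) auto
  also have "\<dots> < \<infinity>"
    using sm by (subst suminf_ennreal2) (auto simp: u_def)
  finally have "AE x in M. (\<Sum>m. ennreal (norm (u m x))) \<noteq> \<infinity>"
    using u by (intro nn_integral_noteq_infinite) auto
  then have AE: "AE x in M. summable (\<lambda>m. norm (u m x))"
    by eventually_elim (rule summable_suminf_not_top, auto)
  define f where "f x = g 0 x + (\<Sum>m. u m x)" for x
  have int_sum: "integrable M (\<lambda>x. \<Sum>m. u m x)"
    by (rule integrable_suminf[OF u AE]) (use sm in \<open>simp add: u_def\<close>)
  show thesis
  proof
    show "integrable M f"
      unfolding f_def using g int_sum by auto
    fix A assume A: "A \<in> sets M"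
    have *: "integrable M (\<lambda>x. indicator A x *\<^sub>R h x)" if "integrable M h" for h :: "'a \<Rightarrow> 'b"
      using A that by (rule integrable_mult_indicator)
    have AE': "AE x in M. summable (\<lambda>m. norm (indicator A x *\<^sub>R u m x))"
      using AE by eventually_elim (auto simp: indicator_def)
    have "summable (\<lambda>m. LINT x|M. norm (indicator A x *\<^sub>R u m x))"
    proof (rule summable_comparison_test'[OF sm])
      fix m
      have "(LINT x|M. norm (indicator A x *\<^sub>R u m x)) \<le> (LINT x|M. norm (u m x))"
        by (intro integral_mono integrable_norm *[OF u] u) (auto simp: indicator_def)
      then show "norm (LINT x|M. norm (indicator A x *\<^sub>R u m x)) \<le> (LINT x|M. norm (g (Suc m) x - g m x))"
        by (simp add: u_def)
    qed
    from sums_integral[OF *[OF u] AE' this]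
    have "(\<lambda>M'. \<Sum>m<M'. LINT x:A|M. u m x) \<longlonglongrightarrow> (LINT x|M. (\<Sum>m. indicator A x *\<^sub>R u m x))"
      by (simp add: sums_def set_lebesgue_integral_def)
    moreover have "(\<Sum>m<M'. LINT x:A|M. u m x) = (LINT x:A|M. g M' x) - (LINT x:A|M. g 0 x)" for M'
    proof -
      have "(LINT x:A|M. u m x) = (LINT x:A|M. g (Suc m) x) - (LINT x:A|M. g m x)" for m
        unfolding u_def using *[OF g] by (intro set_integral_diff) (auto simp: set_integrable_def)
      then show ?thesis using sum_lessThan_telescope[of "\<lambda>m. LINT x:A|M. g m x" M'] by simp
    qed
    moreover have "(LINT x|M. (\<Sum>m. indicator A x *\<^sub>R u m x)) = (LINT x:A|M. (\<Sum>m. u m x))"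
      unfolding set_lebesgue_integral_def
    proof (rule integral_cong_AE)
      show "AE x in M. (\<Sum>m. indicator A x *\<^sub>R u m x) = indicator A x *\<^sub>R (\<Sum>m. u m x)"
        by (auto simp: indicator_def)
    qed (use *[OF u] *[OF int_sum] in auto)
    ultimately have "(\<lambda>M'. (LINT x:A|M. g M' x) - (LINT x:A|M. g 0 x)) \<longlonglongrightarrow> (LINT x:A|M. (\<Sum>m. u m x))"
      by simp
    from tendsto_add[OF this tendsto_const[of "LINT x:A|M. g 0 x"]]
    have "(\<lambda>M'. (LINT x:A|M. g M' x)) \<longlonglongrightarrow> (LINT x:A|M. (\<Sum>m. u m x)) + (LINT x:A|M. g 0 x)"
      by simp
    also have "(LINT x:A|M. (\<Sum>m. u m x)) + (LINT x:A|M. g 0 x) = (LINT x:A|M. f x)"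
      unfolding f_def using *[OF g] *[OF int_sum]
      by (subst set_integral_add) (auto simp: set_integrable_def add.commute)
    finally show "(\<lambda>m. LINT x:A|M. g m x) \<longlonglongrightarrow> (LINT x:A|M. f x)" .
  qed
qed

text \<open>Writes partial sums of different lengths with a common length, so that their difference
  is again a single \<open>trig_poly\<close> to which Parseval applies.\<close>

lemma trig_poly_cut:
  assumes "M \<le> N"
  shows "trig_poly (\<lambda>k. (if k \<le> M then 1 else 0) * c k) N x = trig_poly c M x"
proof -
  have "trig_poly (\<lambda>k. (if k \<le> M then 1 else 0) * c k) N x = (\<Sum>k\<le>N. if k \<in> {..M} then c k * cis (real k * x) else 0)"
    unfolding trig_poly_def by (rule sum.cong) auto
  also have "\<dots> = (\<Sum>k\<in>{..N} \<inter> {..M}. c k * cis (real k * x))"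
    by (rule sum.inter_restrict[symmetric]) simp
  also have "{..N} \<inter> {..M} = {..M}" using assms by auto
  finally show ?thesis by (simp add: trig_poly_def)
qed

lemma trig_poly_diff: "trig_poly a N x - trig_poly b N x = trig_poly (\<lambda>k. a k - b k) N x"
  by (simp add: trig_poly_def left_diff_distrib sum_subtractf)

lemma fast_subsequence:
  fixes s :: "nat \<Rightarrow> real"
  assumes "convergent s" and "\<And>m. 0 < e m"
  obtains r :: "nat \<Rightarrow> nat" where "mono r" "\<And>m. m \<le> r m" "\<And>m i j. r m \<le> i \<Longrightarrow> r m \<le> j \<Longrightarrow> \<bar>s i - s j\<bar> \<le> e m"
proof -
  have "\<forall>m. \<exists>R. \<forall>i\<ge>R. \<forall>j\<ge>R. \<bar>s i - s j\<bar> \<le> e m"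
  proof
    fix m
    have "Cauchy s" using assms(1) by (simp add: Cauchy_convergent_iff)
    with assms(2)[of m] obtain R where "\<forall>i\<ge>R. \<forall>j\<ge>R. norm (s i - s j) < e m"
      unfolding Cauchy_iff by meson
    then show "\<exists>R. \<forall>i\<ge>R. \<forall>j\<ge>R. \<bar>s i - s j\<bar> \<le> e m"
      by (metis less_imp_le real_norm_def)
  qed
  then obtain R where R: "\<And>m i j. R m \<le> i \<Longrightarrow> R m \<le> j \<Longrightarrow> \<bar>s i - s j\<bar> \<le> e m"
    by metis
  \<comment> \<open>Accumulating the thresholds makes \<open>r\<close> monotone and at least
    \<open>R m\<close>; the added 1 ensures \<open>m \<le> r m\<close>.\<close>
  define r where "r m = (\<Sum>i\<le>m. R i + 1)" for m
  show thesis
  proof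
    show "mono r"
      unfolding r_def by (intro monoI sum_mono2) auto
    show "m \<le> r m" for m
    proof -
      have "m \<le> (\<Sum>i\<le>m. 1 :: nat)" by simp
      also have "\<dots> \<le> r m" unfolding r_def by (rule sum_mono) simp
      finally show ?thesis .
    qed
    have "R m \<le> r m" for m
      unfolding r_def using member_le_sum[of m "{..m}" "\<lambda>i. R i + 1"] by simp
    then show "\<bar>s i - s j\<bar> \<le> e m" if "r m \<le> i" "r m \<le> j" for m i j
      using that R[of m i j] order_trans by blast
  qed
qed

text \<open>The function with Fourier coefficients \<open>c\<close>, seen only through its integrals over intervals.\<close>

lemma l2_fourier_function:
  assumes sm: "summable (\<lambda>k. (cmod (c k))\<^sup>2)"
  obtains f r where "integrable window f" "\<And>m. m \<le> r m"
    "\<And>a b. {a..b} \<subseteq> {0..4 * pi} \<Longrightarrow> (\<lambda>m. integral {a..b} (trig_poly c (r m))) \<longlonglongrightarrow> integral {a..b} f"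
proof -
  define s where "s N = (\<Sum>k\<le>N. (cmod (c k))\<^sup>2)" for N
  have "convergent s"
    using sm unfolding s_def by (simp add: summable_iff_convergent')
  \<comment> \<open>Square sums of blocks below \<open>(1/4) ^ m\<close> mean L2 distances of order
    \<open>(1/2) ^ m\<close>, which are summable.\<close>
  moreover have "(0::real) < (1/4) ^ m" for m by simp
  ultimately obtain r where r: "mono r" "\<And>m. m \<le> r m"
    "\<And>m i j. r m \<le> i \<Longrightarrow> r m \<le> j \<Longrightarrow> \<bar>s i - s j\<bar> \<le> (1/4) ^ m"
    by (rule fast_subsequence[where e = "\<lambda>m. (1/4) ^ m"]) (rule that; assumption | blast)
  define d where "d m k = (if k \<le> r m then 0 else c k)" for m k
  have diff: "trig_poly c (r (Suc m)) x - trig_poly c (r m) x = trig_poly (d m) (r (Suc m)) x" for m x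
  proof -
    have "r m \<le> r (Suc m)" using r(1) by (simp add: mono_def)
    then have "trig_poly c (r m) x = trig_poly (\<lambda>k. (if k \<le> r m then 1 else 0) * c k) (r (Suc m)) x"
      by (simp add: trig_poly_cut)
    moreover have "d m = (\<lambda>k. c k - (if k \<le> r m then 1 else 0) * c k)"
      by (auto simp: d_def fun_eq_iff)
    ultimately show ?thesis by (simp only: trig_poly_diff)
  qed
  have dsum: "(\<Sum>k\<le>r (Suc m). (cmod (d m k))\<^sup>2) \<le> (1/4) ^ m" for m
  proof -
    have le: "r m \<le> r (Suc m)" using r(1) by (simp add: mono_def)
    have "(\<Sum>k\<le>r (Suc m). (cmod (d m k))\<^sup>2)
        = (\<Sum>k\<le>r (Suc m). (cmod (c k))\<^sup>2 - (if k \<in> {..r m} then (cmod (c k))\<^sup>2 else 0))"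
      by (rule sum.cong) (auto simp: d_def)
    also have "\<dots> = s (r (Suc m)) - (\<Sum>k\<in>{..r (Suc m)} \<inter> {..r m}. (cmod (c k))\<^sup>2)"
      unfolding sum_subtractf s_def by (subst sum.inter_restrict) simp_all
    also have "{..r (Suc m)} \<inter> {..r m} = {..r m}" using le by auto
    also have "s (r (Suc m)) - (\<Sum>k\<in>{..r m}. (cmod (c k))\<^sup>2) \<le> (1/4) ^ m"
      using r(3)[of m "r (Suc m)" "r m"] le by (simp add: s_def abs_le_iff)
    finally show ?thesis .
  qed
  have L1: "(LINT x|window. norm (trig_poly c (r (Suc m)) x - trig_poly c (r m) x)) \<le> 4 * pi * (1/2) ^ m" for m
  proof -
    let ?g = "trig_poly (d m) (r (Suc m))" and ?t = "(1/2 :: real) ^ m"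
    \<comment> \<open>The arithmetic-geometric mean inequality with weight \<open>(1/2) ^ m\<close>
      takes the place of Cauchy-Schwarz: it passes from L2 to L1, and both terms end up of order
      \<open>(1/2) ^ m\<close>.\<close>
    have pt: "cmod (?g x) \<le> ?t / 2 + (cmod (?g x))\<^sup>2 / (2 * ?t)" for x
    proof -
      have "0 \<le> (cmod (?g x) - ?t)\<^sup>2" by simp
      then have "2 * ?t * cmod (?g x) \<le> ?t * ?t + (cmod (?g x))\<^sup>2"
        by (simp add: power2_eq_square algebra_simps)
      then have "2 * ?t * cmod (?g x) / (2 * ?t) \<le> (?t * ?t + (cmod (?g x))\<^sup>2) / (2 * ?t)"
        by (rule divide_right_mono) simp
      then show ?thesis by (simp add: add_divide_distrib)
    qed
    have "(LINT x|window. norm (?g x)) \<le> (LINT x|window. ?t / 2 + (cmod (?g x))\<^sup>2 / (2 * ?t))"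
      by (intro integral_mono pt Bochner_Integration.integrable_add integrable_norm integrable_trig_poly
          integrable_divide_zero parseval_trig_poly(1) integral_window_const(1))
    also have "\<dots> = 4 * pi * (?t / 2) + 4 * pi * (\<Sum>k\<le>r (Suc m). (cmod (d m k))\<^sup>2) / (2 * ?t)"
      by (subst Bochner_Integration.integral_add)
        (intro integrable_divide_zero parseval_trig_poly(1) integral_window_const(1)
          | simp only: integral_divide_zero parseval_trig_poly(2) integral_window_const(2))+
    also have "\<dots> \<le> 4 * pi * (?t / 2) + 4 * pi * (?t * ?t) / (2 * ?t)"
      using dsum[of m] by (intro add_left_mono divide_right_mono mult_left_mono)
        (auto simp flip: power_mult_distrib)
    also have "\<dots> = 4 * pi * ?t" by simp
    finally show ?thesis by (simp only: diff)
  qed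
  have "summable (\<lambda>m. LINT x|window. norm (trig_poly c (r (Suc m)) x - trig_poly c (r m) x))"
  proof (rule summable_comparison_test')
    show "summable (\<lambda>m. 4 * pi * (1/2 :: real) ^ m)"
      by (intro summable_mult summable_geometric) simp
  qed (use L1 in simp)
  with integrable_trig_poly obtain f where f: "integrable window f"
    "\<And>A. A \<in> sets window \<Longrightarrow> (\<lambda>m. LINT x:A|window. trig_poly c (r m) x) \<longlonglongrightarrow> (LINT x:A|window. f x)"
    by (rule L1_limit_of_summable_increments[of window "\<lambda>m. trig_poly c (r m)"]) (rule that; assumption | blast)
  show thesis
  proof
    show "integrable window f" "\<And>m. m \<le> r m" by (fact f(1) r(2))+
    fix a b :: real assume ab: "{a..b} \<subseteq> {0..4 * pi}"
    then have "{a..b} \<in> sets window"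
      by (auto simp: window_def sets_restrict_space image_iff intro!: bexI[of _ "{a..b}"])
    from f(2)[OF this]
    show "(\<lambda>m. integral {a..b} (trig_poly c (r m))) \<longlonglongrightarrow> integral {a..b} f"
      using set_integral_window(2)[OF integrable_trig_poly ab] set_integral_window(2)[OF f(1) ab] by simp
  qed
qed

section \<open>Differentiation of means and Kolmogorov's argument\<close>

lemma AE_tendsto_mean:
  fixes f :: "real \<Rightarrow> complex"
  assumes f: "integrable window f"
  shows "AE x in lborel. x \<in> {0..2 * pi} \<longrightarrow> ((\<lambda>h. integral {x..x + h} f / of_real h) \<longlongrightarrow> f x) (at_right 0)"
proof -
  define F where "F x = (if x \<in> {0..4 * pi} then f x else 0)" for x
  have "f integrable_on {0..4 * pi}"
    using set_integral_window(1)[OF f] by simp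
  then have "F integrable_on UNIV"
    unfolding F_def by (simp only: integrable_restrict_UNIV)
  then have "F integrable_on cbox a b" for a b
    by (rule integrable_on_subcbox) simp
  then obtain N where N: "negligible N"
    "\<And>x e. \<lbrakk>x \<notin> N; 0 < e\<rbrakk> \<Longrightarrow> \<exists>d>0. \<forall>h. 0 < h \<and> h < d \<longrightarrow>
        norm (integral (cbox x (x + h *\<^sub>R One)) F /\<^sub>R h ^ DIM(real) - F x) < e"
    by (rule integrable_ccontinuous_explicit[of F]) (rule that; assumption | blast)
  have "AE x in lborel. x \<notin> N"
  proof -
    have "AE x in lebesgue. x \<notin> N"
      using N(1) unfolding negligible_iff_null_sets by (rule AE_not_in)
    then show ?thesis by (simp only: AE_completion_iff)
  qed
  then show ?thesis
  proof eventually_elim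
    case (elim x)
    show ?case
    proof (intro impI tendstoI)
      fix e :: real assume x: "x \<in> {0..2 * pi}" and "0 < e"
      from N(2)[OF elim \<open>0 < e\<close>] obtain d where d: "d > 0"
        "\<And>h. 0 < h \<Longrightarrow> h < d \<Longrightarrow> norm (integral (cbox x (x + h *\<^sub>R One)) F /\<^sub>R h ^ DIM(real) - F x) < e"
        by blast
      show "\<forall>\<^sub>F h in at_right 0. dist (integral {x..x + h} f / of_real h) (f x) < e"
        unfolding eventually_at_right_field
      \<comment> \<open>For \<open>x \<le> 2 * pi\<close> and \<open>h < 2 * pi\<close> the interval
        stays inside the window, where \<open>F\<close> and \<open>f\<close> agree.\<close>
      proof (intro exI[of _ "min d (2 * pi)"] conjI allI impI)
        fix h assume h: "0 < h" "h < min d (2 * pi)"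
        have "integral {x..x + h} F = integral {x..x + h} f"
          by (rule integral_cong) (use x h in \<open>auto simp: F_def\<close>)
        moreover have "F x = f x" using x by (auto simp: F_def)
        ultimately show "dist (integral {x..x + h} f / of_real h) (f x) < e"
          using d(2)[of h] h by (simp add: dist_norm scaleR_conv_of_real divide_inverse mult.commute)
      qed (use d in simp)
    qed
  qed
qed

theorem lacunary_partial_sums_converge:
  fixes c :: "nat \<Rightarrow> complex" and n :: "nat \<Rightarrow> nat"
  assumes sm: "summable (\<lambda>k. (cmod (c k))\<^sup>2)"
    and lac: "\<And>i. 2 * n i \<le> n (Suc i)" and pos: "\<And>i. 0 < n i"
  shows "AE x in lborel. x \<in> {0..2 * pi} \<longrightarrow> convergent (\<lambda>i. trig_poly c (n i) x)"
proof -
  obtain f r where f: "integrable window f" and r: "\<And>m. m \<le> r m"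
    and lim: "\<And>a b. {a..b} \<subseteq> {0..4 * pi} \<Longrightarrow>
      (\<lambda>m. integral {a..b} (trig_poly c (r m))) \<longlonglongrightarrow> integral {a..b} f"
    using l2_fourier_function[OF sm] by metis
  define h where "h i = 1 / real (n i)" for i
  have h: "0 < h i" "h i \<le> 1" for i
    using pos[of i] by (auto simp: h_def)
  have n_ge: "i < n i" for i
  proof (induction i)
    case (Suc i)
    then show ?case using lac[of i] by linarith
  qed (rule pos)
  define A where "A i x = integral {x..x + h i} f / of_real (h i)" for i x
  \<comment> \<open>\<open>A\<close> averages the limit function, \<open>B\<close> its approximating
    partial sum of length \<open>r m\<close>. Parseval applies to \<open>B\<close>, and the bound is
    carried over to \<open>A\<close> by Fatou's lemma in \<open>m\<close>.\<close>
  define B where "B i m x = trig_poly (\<lambda>k. mean_multiplier (h i) k * c k) (r m) x" for i m x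
  have B_lim: "(\<lambda>m. B i m x) \<longlonglongrightarrow> A i x" if "x \<in> {0..2 * pi}" for i x
  proof -
    have "{x..x + h i} \<subseteq> {0..4 * pi}"
      using that h[of i] pi_ge_two by auto
    from tendsto_divide[OF lim[OF this] tendsto_const, of "of_real (h i)"]
    show ?thesis
      using h[of i] unfolding A_def by (simp add: integral_trig_poly_mean B_def)
  qed
  define S where "S = (\<Sum>k. (cmod (c k))\<^sup>2)"
  define G where "G I m x = ennreal (\<Sum>i<I. (cmod (trig_poly c (n i) x - B i m x))\<^sup>2)" for I m x
  have G_meas [measurable]: "G I m \<in> borel_measurable window" for I m
    unfolding G_def B_def by (rule borel_measurable_window) measurable
  \<comment> \<open>Once \<open>m\<close> reaches \<open>n I\<close>, every cutoff
    \<open>n i\<close> with \<open>i < I\<close> lies below \<open>r m\<close>, so each difference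
    is one trigonometric polynomial with multiplier \<open>w i\<close>.\<close>
  have G_int: "(\<integral>\<^sup>+x. G I m x \<partial>window) \<le> ennreal (40 * pi * S)" if "n I \<le> m" for I m
  proof -
    define w where "w i k = (if k \<le> n i then 1 else 0) - mean_multiplier (h i) k" for i k
    have diff: "trig_poly c (n i) x - B i m x = trig_poly (\<lambda>k. w i k * c k) (r m) x" if "i < I" for i x
    proof -
      have "n i \<le> n I"
      proof (rule lift_Suc_mono_le[of n])
        show "n j \<le> n (Suc j)" for j using lac[of j] by linarith
      qed (use that in simp)
      then have "n i \<le> r m" using \<open>n I \<le> m\<close> r[of m] by linarith
      then have "trig_poly c (n i) x = trig_poly (\<lambda>k. (if k \<le> n i then 1 else 0) * c k) (r m) x"
        by (rule trig_poly_cut[symmetric])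
      then show ?thesis
        unfolding B_def by (simp only: trig_poly_diff w_def left_diff_distrib)
    qed
    have "(\<integral>\<^sup>+x. G I m x \<partial>window)
        = (\<integral>\<^sup>+x. (\<Sum>i<I. ennreal ((cmod (trig_poly (\<lambda>k. w i k * c k) (r m) x))\<^sup>2)) \<partial>window)"
      unfolding G_def by (simp add: diff sum_ennreal)
    also have "\<dots> = (\<Sum>i<I. ennreal (4 * pi * (\<Sum>k\<le>r m. (cmod (w i k * c k))\<^sup>2)))"
      by (subst nn_integral_sum) (simp_all add: nn_integral_trig_poly borel_measurable_window)
    also have "\<dots> = ennreal (\<Sum>i<I. 4 * pi * (\<Sum>k\<le>r m. (cmod (w i k * c k))\<^sup>2))"
      by (simp add: sum_ennreal sum_nonneg)
    also have "(\<Sum>i<I. 4 * pi * (\<Sum>k\<le>r m. (cmod (w i k * c k))\<^sup>2))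
        = 4 * pi * (\<Sum>k\<le>r m. (cmod (c k))\<^sup>2 * (\<Sum>i<I. (cmod (w i k))\<^sup>2))"
      unfolding sum_distrib_left[symmetric]
      by (subst sum.swap) (simp add: norm_mult power_mult_distrib sum_distrib_left mult.commute)
    \<comment> \<open>After exchanging the sums, each frequency carries the total weight over
      \<open>i\<close>, at most 10; with the Parseval factor this gives
      \<open>40 * pi\<close>.\<close>
    also have "\<dots> \<le> 4 * pi * (\<Sum>k\<le>r m. (cmod (c k))\<^sup>2 * 10)"
      using lacunary_multiplier_sum[of n, OF lac pos]
      by (intro mult_left_mono sum_mono) (auto simp: w_def h_def)
    also have "\<dots> = 40 * pi * (\<Sum>k\<le>r m. (cmod (c k))\<^sup>2)"
      by (simp add: sum_distrib_right[symmetric])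
    also have "\<dots> \<le> 40 * pi * S"
      unfolding S_def by (intro mult_left_mono sum_le_suminf sm) auto
    finally show ?thesis by (simp add: ennreal_leI)
  qed
  \<comment> \<open>The lower limit inherits measurability from \<open>G\<close> and is suited to
    Fatou's lemma. On \<open>{0..2 * pi}\<close> it equals the sum of squared distances to
    \<open>A\<close>, by \<open>B_lim\<close>.\<close>
  define D where "D I x = liminf (\<lambda>m. G I m x)" for I x
  have D_meas [measurable]: "D I \<in> borel_measurable window" for I
    unfolding D_def by measurable
  have D_int: "(\<integral>\<^sup>+x. D I x \<partial>window) \<le> ennreal (40 * pi * S)" for I
  proof -
    have "(\<integral>\<^sup>+x. D I x \<partial>window) \<le> liminf (\<lambda>m. \<integral>\<^sup>+x. G I m x \<partial>window)"
      unfolding D_def by (rule nn_integral_liminf) measurable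
    also have "\<dots> \<le> liminf (\<lambda>m. ennreal (40 * pi * S))"
      by (intro Liminf_mono eventually_sequentiallyI[of "n I"] G_int)
    also have "\<dots> = ennreal (40 * pi * S)" by (simp add: Liminf_const)
    finally show ?thesis .
  qed
  have "incseq D"
    unfolding D_def G_def
    by (intro incseq_SucI le_funI Liminf_mono always_eventually allI ennreal_leI) simp
  then have "(\<integral>\<^sup>+x. (SUP I. D I x) \<partial>window) = (SUP I. \<integral>\<^sup>+x. D I x \<partial>window)"
    by (rule nn_integral_monotone_convergence_SUP) measurable
  also have "\<dots> \<le> ennreal (40 * pi * S)"
    using D_int by (intro SUP_least)
  finally have "(\<integral>\<^sup>+x. (SUP I. D I x) \<partial>window) \<noteq> \<infinity>"
    by (auto simp: top_unique)
  then have "AE x in window. (SUP I. D I x) \<noteq> \<infinity>"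
    by (intro nn_integral_noteq_infinite) measurable
  then have "AE x in lborel. x \<in> {0..4 * pi} \<longrightarrow> (SUP I. D I x) \<noteq> \<infinity>"
    unfolding window_def by (subst (asm) AE_restrict_space_iff) auto
  with AE_tendsto_mean[OF f] show ?thesis
  proof eventually_elim
    case (elim x)
    show ?case
    proof
      assume x: "x \<in> {0..2 * pi}"
      define u where "u i = (cmod (trig_poly c (n i) x - A i x))\<^sup>2" for i
      have D: "D I x = ennreal (\<Sum>i<I. u i)" for I
      proof -
        have "(\<lambda>m. G I m x) \<longlonglongrightarrow> ennreal (\<Sum>i<I. u i)"
          unfolding G_def u_def by (intro tendsto_intros B_lim x)
        then show ?thesis unfolding D_def by (simp add: lim_imp_Liminf)
      qed
      have "x \<in> {0..4 * pi}" using x by auto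
      with elim(2) have "(SUP I. D I x) \<noteq> top" by simp
      then obtain C where C: "(SUP I. D I x) = ennreal C" "0 \<le> C"
        by (cases "SUP I. D I x") auto
      have "(\<Sum>i<I. u i) \<le> C" for I
      proof -
        have "ennreal (\<Sum>i<I. u i) \<le> ennreal C"
          using SUP_upper[of I UNIV "\<lambda>I. D I x"] by (simp add: D flip: C(1))
        then show ?thesis using C(2) by (simp add: ennreal_le_iff)
      qed
      then have "summable u"
        by (intro summableI_nonneg_bounded) (auto simp: u_def)
      then have "u \<longlonglongrightarrow> 0" by (rule summable_LIMSEQ_zero)
      then have "(\<lambda>i. sqrt (u i)) \<longlonglongrightarrow> 0"
        using tendsto_real_sqrt by fastforce
      then have diff: "(\<lambda>i. trig_poly c (n i) x - A i x) \<longlonglongrightarrow> 0"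
        unfolding u_def real_sqrt_abs abs_norm_cancel by (rule tendsto_norm_zero_cancel)
      have "h \<longlonglongrightarrow> 0"
      proof (rule tendsto_sandwich[OF _ _ tendsto_const LIMSEQ_inverse_real_of_nat])
        have "h i \<le> inverse (real (Suc i))" for i
          using n_ge[of i] unfolding h_def inverse_eq_divide by (intro divide_left_mono) auto
        then show "\<forall>\<^sub>F i in sequentially. h i \<le> inverse (real (Suc i))" by simp
        show "\<forall>\<^sub>F i in sequentially. 0 \<le> h i"
          using h by (simp add: less_imp_le)
      qed
      then have "filterlim h (at_right 0) sequentially"
        using h(1) by (simp add: filterlim_at less_imp_neq[THEN not_sym])
      then have "(\<lambda>i. A i x) \<longlonglongrightarrow> f x"
        unfolding A_def by (rule filterlim_compose[OF mp[OF elim(1) x]])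
      from tendsto_add[OF diff this]
      show "convergent (\<lambda>i. trig_poly c (n i) x)"
        by (auto simp: convergent_def)
    qed
  qed
qed

section \<open>The lacunary reflection recurrence\<close>

text \<open>Frequencies \<open>M\<close> and \<open>M - 1\<close> are the only ones shared by a spectrum in \<open>{0..M}\<close> and its
  reflection about \<open>N \<ge> 2 * M - 1\<close>; either way the top coefficient is involved.\<close>

lemma reflected_cross_term:
  fixes c :: "nat \<Rightarrow> complex"
  assumes supp: "\<And>k. M < k \<Longrightarrow> c k = 0" and N: "2 * M \<le> Suc N" and "2 \<le> M"
  shows "(\<Sum>k\<le>N. cmod (c k) * cmod (c (N - k))) \<le> 2 * cmod (c M) * sqrt (\<Sum>k\<le>M. (cmod (c k))\<^sup>2)"
proof -
  define E where "E = (\<Sum>k\<le>M. (cmod (c k))\<^sup>2)"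
  have le: "cmod (c k) \<le> sqrt E" for k
  proof (cases "k \<le> M")
    case True
    then have "(cmod (c k))\<^sup>2 \<le> E"
      unfolding E_def by (intro member_le_sum) auto
    then show ?thesis by (rule real_le_rsqrt)
  next
    case False
    then show ?thesis by (simp add: supp E_def sum_nonneg)
  qed
  have bound: "cmod (c k) * cmod (c (N - k)) \<le> (if k \<in> {M - 1, M} then cmod (c M) * sqrt E else 0)"
    if "k \<le> N" for k
  proof -
    consider "k = M" | "k = M - 1" | "M < k" | "k < M - 1" by linarith
    then show ?thesis
    proof cases
      case 1
      then show ?thesis using le[of "N - k"] by (simp add: mult_left_mono)
    next
      case 2
      \<comment> \<open>If \<open>N - k\<close> equals \<open>M\<close>, the second factor is the
        top coefficient; if it exceeds \<open>M\<close>, that factor vanishes.\<close>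
      then have "M \<le> N - k" using N \<open>2 \<le> M\<close> by linarith
      then consider "N - k = M" | "M < N - k" by linarith
      then show ?thesis
      proof cases
        case 1
        have "cmod (c k) * cmod (c M) \<le> cmod (c M) * sqrt E"
          by (subst mult.commute) (intro mult_left_mono le, simp)
        then show ?thesis using 1 2 by simp
      next
        case 2
        have "0 \<le> cmod (c M) * sqrt E" by (simp add: E_def sum_nonneg)
        then show ?thesis using supp[OF 2] by simp
      qed
    next
      case 3
      then show ?thesis using supp[of k] by simp
    next
      case 4
      then have "M < N - k" using N by linarith
      then show ?thesis using supp[of "N - k"] 4 by simp
    qed
  qed
  have "(\<Sum>k\<le>N. cmod (c k) * cmod (c (N - k))) \<le> (\<Sum>k\<le>N. if k \<in> {M - 1, M} then cmod (c M) * sqrt E else 0)"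
    using bound by (intro sum_mono) simp
  also have "\<dots> = (\<Sum>k\<in>{..N} \<inter> {M - 1, M}. cmod (c M) * sqrt E)"
    by (rule sum.inter_restrict[symmetric]) simp
  also have "\<dots> \<le> (\<Sum>k\<in>{M - 1, M}. cmod (c M) * sqrt E)"
    by (rule sum_mono2) (auto simp: E_def sum_nonneg)
  also have "\<dots> = 2 * cmod (c M) * sqrt E"
    using \<open>2 \<le> M\<close> by simp
  finally show ?thesis by (simp add: E_def)
qed

lemma norm_diff_mult_cnj_square:
  "(cmod (a - d * cnj b))\<^sup>2 \<le> (cmod a)\<^sup>2 + (cmod d)\<^sup>2 * (cmod b)\<^sup>2 + 2 * cmod d * (cmod a * cmod b)"
proof -
  have "(cmod (a - d * cnj b))\<^sup>2 \<le> (cmod a + cmod (d * cnj b))\<^sup>2"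
    by (intro power_mono norm_triangle_ineq4) simp
  then show ?thesis by (simp add: norm_mult power2_eq_square algebra_simps)
qed

text \<open>\<open>refl_coeff n d j k\<close> is the coefficient of \<open>z ^ k\<close> in the reversed polynomial after the first
  \<open>j\<close> nontrivial recurrence steps.\<close>

fun refl_coeff :: "(nat \<Rightarrow> nat) \<Rightarrow> (nat \<Rightarrow> complex) \<Rightarrow> nat \<Rightarrow> nat \<Rightarrow> complex" where
  "refl_coeff n d 0 k = (if k = 0 then 1 else 0)"
| "refl_coeff n d (Suc j) k = refl_coeff n d j k
     - (if k \<le> Suc (n (Suc j)) then d (Suc j) * cnj (refl_coeff n d j (Suc (n (Suc j)) - k)) else 0)"

locale lacunary_reflection =
  fixes n :: "nat \<Rightarrow> nat" and d :: "nat \<Rightarrow> complex"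
  assumes n0: "n 0 = 1" and lac: "\<And>j. 2 * n j \<le> n (Suc j)"
    and d_l2: "summable (\<lambda>j. (cmod (d j))\<^sup>2)"
begin

abbreviation "c \<equiv> refl_coeff n d"

lemma n_pos: "0 < n j"
proof (induction j)
  case (Suc j)
  then show ?case using lac[of j] by linarith
qed (simp add: n0)

lemma n_ge: "j < n j"
proof (induction j)
  case (Suc j)
  then show ?case using lac[of j] by linarith
qed (simp add: n0)

section \<open>Spectrum and energy of the reversed polynomials\<close>

lemma coeff_vanish: "Suc (n j) < k \<Longrightarrow> c j k = 0"
proof (induction j arbitrary: k)
  case (Suc j)
  then show ?case using lac[of j] by simp
qed simp

lemma coeff_0: "c j 0 = 1"
proof (induction j)
  case (Suc j)
  have "Suc (n j) < Suc (n (Suc j))" using lac[of j] n_pos[of j] by linarith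
  then show ?case using Suc coeff_vanish[of j "Suc (n (Suc j))"] by simp
qed simp

text \<open>The old spectrum ends below the new top frequency, so the new top coefficient is only
  the reflected constant term 1 times \<open>- d j\<close>. At \<open>j = 0\<close> it is
  zero.\<close>

lemma norm_coeff_top: "cmod (c j (Suc (n j))) \<le> cmod (d j)"
proof (cases j)
  case (Suc i)
  have "Suc (n i) < Suc (n (Suc i))" using lac[of i] n_pos[of i] by linarith
  then show ?thesis using Suc coeff_vanish[of i "Suc (n (Suc i))"] by (simp add: coeff_0 norm_mult)
qed simp

text \<open>Up to the factor in Parseval's identity, this is the squared L2 norm in Lebesgue measure
  of the reversed polynomial after \<open>j\<close> steps.\<close>

definition energy :: "nat \<Rightarrow> real" where
  "energy j = (\<Sum>k\<le>Suc (n j). (cmod (c j k))\<^sup>2)"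

lemma energy_eq: "Suc (n j) \<le> N \<Longrightarrow> (\<Sum>k\<le>N. (cmod (c j k))\<^sup>2) = energy j"
  unfolding energy_def by (rule sum.mono_neutral_right) (auto simp: coeff_vanish)

lemma energy_ge_1: "1 \<le> energy j"
proof -
  have "(cmod (c j 0))\<^sup>2 \<le> energy j"
    unfolding energy_def by (rule member_le_sum) auto
  then show ?thesis by (simp add: coeff_0)
qed

text \<open>With disjoint spectra the factor would be \<open>1 + (cmod (d (Suc j)))\<^sup>2\<close>.
  The overlap adds \<open>4 * cmod (d (Suc j)) * cmod (d j)\<close>, which is split into squares so
  that the excess is summable.\<close>

lemma energy_Suc: "energy (Suc j) \<le> energy j * (1 + (3 * (cmod (d (Suc j)))\<^sup>2 + 2 * (cmod (d j))\<^sup>2))"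
proof -
  define N where "N = Suc (n (Suc j))"
  define D where "D = cmod (d (Suc j))"
  have N: "Suc (n j) \<le> N" "2 * Suc (n j) \<le> Suc N"
    unfolding N_def using lac[of j] n_pos[of j] by simp_all
  have cross: "(\<Sum>k\<le>N. cmod (c j k) * cmod (c j (N - k))) \<le> 2 * cmod (d j) * energy j"
  proof -
    have "(\<Sum>k\<le>N. cmod (c j k) * cmod (c j (N - k))) \<le> 2 * cmod (c j (Suc (n j))) * sqrt (energy j)"
      unfolding energy_def using coeff_vanish N n_pos[of j] by (intro reflected_cross_term) auto
    also have "\<dots> \<le> 2 * cmod (d j) * energy j"
    proof (intro mult_mono)
      \<comment> \<open>The constant coefficient 1 keeps the energy at least 1, which makes the
        cross term linear in the energy.\<close>
      show "sqrt (energy j) \<le> energy j"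
        using energy_ge_1[of j] by (intro real_le_lsqrt self_le_power) auto
    qed (use norm_coeff_top[of j] energy_ge_1[of j] in auto)
    finally show ?thesis .
  qed
  have reflected: "(\<Sum>k\<le>N. (cmod (c j (N - k)))\<^sup>2) = energy j"
    unfolding energy_eq[OF N(1), symmetric]
    by (rule sum.reindex_bij_witness[where i = "\<lambda>k. N - k" and j = "\<lambda>k. N - k"]) auto
  have "energy (Suc j) = (\<Sum>k\<le>N. (cmod (c j k - d (Suc j) * cnj (c j (N - k))))\<^sup>2)"
    unfolding energy_def N_def by (rule sum.cong) auto
  also have "\<dots> \<le> (\<Sum>k\<le>N. (cmod (c j k))\<^sup>2 + D\<^sup>2 * (cmod (c j (N - k)))\<^sup>2
      + 2 * D * (cmod (c j k) * cmod (c j (N - k))))"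
    unfolding D_def by (intro sum_mono norm_diff_mult_cnj_square)
  also have "\<dots> = energy j + D\<^sup>2 * energy j + 2 * D * (\<Sum>k\<le>N. cmod (c j k) * cmod (c j (N - k)))"
    by (simp only: sum.distrib energy_eq[OF N(1)] reflected sum_distrib_left[symmetric])
  also have "\<dots> \<le> energy j + D\<^sup>2 * energy j + 2 * D * (2 * cmod (d j) * energy j)"
    by (intro add_left_mono mult_left_mono cross) (simp add: D_def)
  also have "\<dots> = energy j * (1 + D\<^sup>2 + 2 * (2 * D * cmod (d j)))"
    by (simp add: algebra_simps)
  also have "\<dots> \<le> energy j * (1 + D\<^sup>2 + 2 * (D\<^sup>2 + (cmod (d j))\<^sup>2))"
    using energy_ge_1[of j] sum_squares_bound[of D "cmod (d j)"] by (intro mult_left_mono add_left_mono) auto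
  finally show ?thesis by (simp add: D_def algebra_simps)
qed

lemma energy_bounded: "\<exists>K\<ge>1. \<forall>j. energy j \<le> K"
proof -
  define e where "e j = 3 * (cmod (d (Suc j)))\<^sup>2 + 2 * (cmod (d j))\<^sup>2" for j
  have e: "0 \<le> e j" for j by (simp add: e_def)
  have "summable (\<lambda>j. (cmod (d (Suc j)))\<^sup>2)"
    using d_l2 by (subst summable_Suc_iff)
  then have sm: "summable e"
    unfolding e_def using d_l2 by (intro summable_add summable_mult)
  have "energy j \<le> energy 0 * exp (\<Sum>i<j. e i)" for j
  proof (induction j)
    case (Suc j)
    have "energy (Suc j) \<le> energy j * (1 + e j)"
      using energy_Suc[of j] by (simp add: e_def)
    also have "\<dots> \<le> (energy 0 * exp (\<Sum>i<j. e i)) * exp (e j)"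
      using e[of j] energy_ge_1[of 0] by (intro mult_mono Suc exp_ge_add_one_self) auto
    finally show ?case by (simp add: exp_add mult.assoc)
  qed simp
  also have "energy 0 * exp (\<Sum>i<j. e i) \<le> energy 0 * exp (suminf e)" for j
    using e sm energy_ge_1[of 0] by (intro mult_left_mono iffD2[OF exp_le_cancel_iff] sum_le_suminf) auto
  finally have "energy j \<le> energy 0 * exp (suminf e)" for j .
  then show ?thesis using energy_ge_1 order_trans by blast
qed

text \<open>For \<open>k < n j\<close>, reflection about \<open>Suc (n (Suc j))\<close> leads beyond
  \<open>Suc (n j)\<close>, where the old coefficients vanish. Later steps therefore leave low
  frequencies alone.\<close>

lemma coeff_stable: "i \<le> j \<Longrightarrow> k < n i \<Longrightarrow> c j k = c i k"
proof (induction j rule: dec_induct)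
  case (step j)
  have "n i \<le> n j"
    using step(1) by (rule lift_Suc_mono_le[of n, rotated]) (use lac in \<open>metis le_add1 mult_2 order_trans\<close>)
  then have "Suc (n j) < Suc (n (Suc j)) - k" using lac[of j] step by linarith
  then show ?case using step coeff_vanish by simp
qed simp

text \<open>The limit of \<open>c j k\<close> as \<open>j\<close> grows: the sequence is constant once \<open>k < n j\<close>, and \<open>k < n k\<close>.\<close>

definition limit_coeff :: "nat \<Rightarrow> complex" where
  "limit_coeff k = c k k"

lemma coeff_eq_limit: "k < n j \<Longrightarrow> c j k = limit_coeff k"
  unfolding limit_coeff_def using coeff_stable[of j k k] coeff_stable[of k j k] n_ge[of k] by (cases "j \<le> k") simp_all

lemma limit_coeff_l2: "summable (\<lambda>k. (cmod (limit_coeff k))\<^sup>2)"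
proof -
  obtain K where K: "\<And>j. energy j \<le> K" using energy_bounded by blast
  show ?thesis
  proof (rule summableI_nonneg_bounded)
    fix N
    have "(\<Sum>k<N. (cmod (limit_coeff k))\<^sup>2) = (\<Sum>k<N. (cmod (c N k))\<^sup>2)"
      using n_ge[of N] by (intro sum.cong) (auto simp: coeff_eq_limit)
    also have "\<dots> \<le> energy N"
      unfolding energy_def using n_ge[of N] by (intro sum_mono2) auto
    also note K
    finally show "(\<Sum>k<N. (cmod (limit_coeff k))\<^sup>2) \<le> K" .
  qed simp
qed

text \<open>Conjugation followed by multiplication with the exponential of frequency N sends
  frequency k to N - k. Here N is \<open>Suc (n (Suc j))\<close>, as in the second summand of
  \<open>refl_coeff\<close>.\<close>

lemma trig_poly_coeff_Suc:
  "trig_poly (c (Suc j)) (Suc (n (Suc j))) x = trig_poly (c j) (Suc (n j)) x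
     - d (Suc j) * cis (real (Suc (n (Suc j))) * x) * cnj (trig_poly (c j) (Suc (n j)) x)"
proof -
  define N where "N = Suc (n (Suc j))"
  have "Suc (n j) \<le> N" unfolding N_def using lac[of j] by simp
  then have T: "trig_poly (c j) (Suc (n j)) x = (\<Sum>k\<le>N. c j k * cis (real k * x))"
    unfolding trig_poly_def by (intro sum.mono_neutral_left) (auto simp: coeff_vanish)
  have term_eq: "cis (real N * x) * cnj (c j k * cis (real k * x)) = cnj (c j k) * cis (real (N - k) * x)"
    if "k \<le> N" for k
  proof -
    have "real N * x - real k * x = real (N - k) * x"
      using that by (simp add: of_nat_diff left_diff_distrib)
    then have "cis (real N * x) * cnj (cis (real k * x)) = cis (real (N - k) * x)"
      by (simp only: cis_mult_cnj_cis)
    then show ?thesis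
      by (simp only: complex_cnj_mult mult.left_commute[of "cis (real N * x)"])
  qed
  have "cis (real N * x) * cnj (\<Sum>k\<le>N. c j k * cis (real k * x)) = (\<Sum>k\<le>N. cnj (c j k) * cis (real (N - k) * x))"
    unfolding cnj_sum sum_distrib_left by (rule sum.cong) (simp_all only: term_eq atMost_iff)
  also have "\<dots> = (\<Sum>k\<le>N. cnj (c j (N - k)) * cis (real k * x))"
    by (rule sum.reindex_bij_witness[where i = "\<lambda>k. N - k" and j = "\<lambda>k. N - k"]) auto
  finally have refl: "cis (real N * x) * cnj (\<Sum>k\<le>N. c j k * cis (real k * x))
      = (\<Sum>k\<le>N. cnj (c j (N - k)) * cis (real k * x))" .
  have "trig_poly (c (Suc j)) N x = (\<Sum>k\<le>N. c j k * cis (real k * x) - d (Suc j) * (cnj (c j (N - k)) * cis (real k * x)))"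
    unfolding trig_poly_def by (rule sum.cong) (auto simp: N_def algebra_simps)
  also have "\<dots> = (\<Sum>k\<le>N. c j k * cis (real k * x)) - d (Suc j) * (\<Sum>k\<le>N. cnj (c j (N - k)) * cis (real k * x))"
    by (simp only: sum_subtractf sum_distrib_left)
  also have "\<dots> = (\<Sum>k\<le>N. c j k * cis (real k * x))
      - d (Suc j) * cis (real N * x) * cnj (\<Sum>k\<le>N. c j k * cis (real k * x))"
    by (simp only: refl[symmetric] mult.assoc)
  finally show ?thesis by (simp only: T N_def)
qed

text \<open>The two sums differ only at frequencies \<open>n j\<close> and \<open>Suc (n j)\<close>.
  The coefficient at the first still changes by a multiple of \<open>d (Suc j)\<close>; the second
  is the top one, of size at most \<open>cmod (d j)\<close>.\<close>

lemma trig_poly_coeff_near_limit: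
  "(\<lambda>j. trig_poly (c j) (Suc (n j)) x - trig_poly limit_coeff (n j) x) \<longlonglongrightarrow> 0"
proof -
  obtain K where K: "1 \<le> K" "\<And>j. energy j \<le> K" using energy_bounded by blast
  have coeff_le: "cmod (c j k) \<le> K" for j k
  proof (cases "k \<le> Suc (n j)")
    case True
    then have "(cmod (c j k))\<^sup>2 \<le> energy j"
      unfolding energy_def by (intro member_le_sum) auto
    \<comment> \<open>Since \<open>K\<close> is at least 1, it also bounds the square root of the
      energy.\<close>
    also have "energy j \<le> K\<^sup>2"
      using K(2)[of j] self_le_power[OF K(1), of 2] by simp
    finally show ?thesis by (rule power2_le_imp_le) (use K(1) in simp)
  qed (use K(1) in \<open>simp add: coeff_vanish\<close>)
  have diff: "trig_poly (c j) (Suc (n j)) x - trig_poly limit_coeff (n j) x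
      = (c j (n j) - limit_coeff (n j)) * cis (real (n j) * x) + c j (Suc (n j)) * cis (real (Suc (n j)) * x)" for j
  proof -
    have "(\<Sum>k<n j. c j k * cis (real k * x)) = (\<Sum>k<n j. limit_coeff k * cis (real k * x))"
      by (rule sum.cong) (auto simp: coeff_eq_limit)
    then show ?thesis
      unfolding trig_poly_def sum.atMost_Suc
      by (simp only: lessThan_Suc_atMost[symmetric] sum.lessThan_Suc) (simp add: algebra_simps)
  qed
  have bound: "norm (trig_poly (c j) (Suc (n j)) x - trig_poly limit_coeff (n j) x) \<le> K * cmod (d (Suc j)) + cmod (d j)" for j
  proof -
    have "n j < n (Suc j)" using lac[of j] n_pos[of j] by linarith
    then have "limit_coeff (n j) = c j (n j) - d (Suc j) * cnj (c j (Suc (n (Suc j)) - n j))"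
      using coeff_eq_limit[of "n j" "Suc j"] by simp
    then have "c j (n j) - limit_coeff (n j) = d (Suc j) * cnj (c j (Suc (n (Suc j)) - n j))"
      by (simp only: diff_diff_eq2 diff_add_cancel add_diff_cancel_left')
    then have "cmod (c j (n j) - limit_coeff (n j)) \<le> K * cmod (d (Suc j))"
      using mult_left_mono[OF coeff_le, of "cmod (d (Suc j))"] by (simp add: norm_mult mult.commute[of K])
    then have "cmod ((c j (n j) - limit_coeff (n j)) * cis (real (n j) * x)) \<le> K * cmod (d (Suc j))"
      by (simp add: norm_mult)
    moreover have "cmod (c j (Suc (n j)) * cis (real (Suc (n j)) * x)) \<le> cmod (d j)"
      using norm_coeff_top[of j] by (simp add: norm_mult)
    ultimately show ?thesis
      unfolding diff by (intro norm_triangle_mono)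
  qed
  have "(\<lambda>j. sqrt ((cmod (d j))\<^sup>2)) \<longlonglongrightarrow> sqrt 0"
    by (intro tendsto_real_sqrt summable_LIMSEQ_zero d_l2)
  then have d0: "(\<lambda>j. cmod (d j)) \<longlonglongrightarrow> 0" by simp
  have "(\<lambda>j. K * cmod (d (Suc j)) + cmod (d j)) \<longlonglongrightarrow> K * 0 + 0"
    by (intro tendsto_intros d0 LIMSEQ_Suc[OF d0])
  then have "(\<lambda>j. K * cmod (d (Suc j)) + cmod (d j)) \<longlonglongrightarrow> 0" by simp
  then show ?thesis
    by (rule Lim_null_comparison[OF always_eventually, rotated]) (use bound in blast)
qed

theorem reflection_recurrence_converges:
  assumes b0: "\<And>x. b 0 x = 1"
    and bSuc: "\<And>j x. b (Suc j) x = b j x - d (Suc j) * cis (real (Suc (n (Suc j))) * x) * cnj (b j x)"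
  shows "AE x in lborel. x \<in> {0..2 * pi} \<longrightarrow> convergent (\<lambda>j. b j x)"
proof -
  have b: "b j x = trig_poly (c j) (Suc (n j)) x" for j x
  proof (induction j)
    case 0
    show ?case
      unfolding trig_poly_def b0 by (subst sum.remove[of _ 0]) auto
  next
    case (Suc j)
    then show ?case by (simp only: bSuc trig_poly_coeff_Suc)
  qed
  show ?thesis
    using lacunary_partial_sums_converge[of limit_coeff n, OF limit_coeff_l2 lac n_pos]
  proof eventually_elim
    case (elim x)
    show ?case
    proof
      assume "x \<in> {0..2 * pi}"
      with elim have "convergent (\<lambda>j. trig_poly limit_coeff (n j) x)" by blast
      from convergent_add[OF this convergentI[OF trig_poly_coeff_near_limit[of x]]]
      show "convergent (\<lambda>j. b j x)" by (simp add: b)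
    qed
  qed
qed

end

section \<open>Convergence of the reversed polynomials\<close>

lemma lacunary_step_constant:
  fixes n :: "nat \<Rightarrow> nat"
  assumes n: "strict_mono n" and X: "\<And>k. k \<notin> n ` {1..} \<Longrightarrow> X (Suc k) = X k"
    and k: "n j < k" "k \<le> n (Suc j)"
  shows "X k = X (Suc (n j))"
proof -
  have "Suc (n j) \<le> k" using k(1) by simp
  then show ?thesis using k(2)
  proof (induction k rule: dec_induct)
    case (step k)
    have "k \<notin> n ` {1..}"
    proof
      assume "k \<in> n ` {1..}"
      then obtain i where "k = n i" by blast
      then have "n j < n i" "n i < n (Suc j)" using step by simp_all
      then show False using strict_mono_less[OF n] by simp
    qed
    then show ?case using X[of k] step by simp
  qed simp
qed

text \<open>Beyond \<open>n J\<close> the sequence takes only values \<open>X (Suc (n j))\<close>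
  with \<open>j \<ge> J\<close>, so convergence along the jumps is convergence of the whole
  sequence.\<close>

lemma lacunary_step_convergent:
  fixes n :: "nat \<Rightarrow> nat" and X :: "nat \<Rightarrow> 'a :: real_normed_vector"
  assumes n: "strict_mono n" and X: "\<And>k. k \<notin> n ` {1..} \<Longrightarrow> X (Suc k) = X k"
    and conv: "convergent (\<lambda>j. X (Suc (n j)))"
  shows "convergent X"
proof -
  obtain L where L: "(\<lambda>j. X (Suc (n j))) \<longlonglongrightarrow> L" using conv by (auto simp: convergent_def)
  have "X \<longlonglongrightarrow> L"
  proof (rule LIMSEQ_I)
    fix e :: real assume "0 < e"
    with L obtain J where J: "\<And>j. J \<le> j \<Longrightarrow> norm (X (Suc (n j)) - L) < e"
      using LIMSEQ_D by blast
    have reach: "\<exists>j\<ge>J. X k = X (Suc (n j))" if "Suc (n J) \<le> k" for k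
      using that
    proof (induction k rule: dec_induct)
      case (step k)
      show ?case
      proof (cases "k \<in> n ` {1..}")
        case True
        then obtain i where i: "k = n i" by blast
        then have "n J < n i" using step by simp
        then show ?thesis using strict_mono_less[OF n, of J i] i by (intro exI[of _ i]) simp
      qed (use X[of k] step in auto)
    qed blast
    show "\<exists>K. \<forall>k\<ge>K. norm (X k - L) < e"
      using reach J by metis
  qed
  then show ?thesis by (rule convergentI)
qed

text \<open>The inverses increase by factors at most \<open>exp (C * t j)\<close>, with
  \<open>C = 1 / (1 - r)\<close> finite as \<open>t\<close> stays away from 1. Working with inverses
  avoids a separate proof that the limit of \<open>V\<close> is positive.\<close>

lemma convergent_inverse_products:
  fixes V t :: "nat \<Rightarrow> real"
  assumes V: "\<And>j. 0 < V j" "\<And>j. V (Suc j) = (1 - t j) * V j"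
    and t: "\<And>j. 0 \<le> t j" "\<And>j. t j \<le> r" "r < 1" and sm: "summable t"
  shows "convergent (\<lambda>j. 1 / V j)"
proof -
  define C where "C = 1 / (1 - r)"
  have C: "0 \<le> C" using t(3) by (simp add: C_def)
  have step: "1 / V (Suc j) = 1 / V j * (1 / (1 - t j))" for j
    by (simp add: V(2))
  have lower: "1 \<le> 1 / (1 - t j)" for j
    using t(1,2)[of j] t(3) by simp
  have upper: "1 / (1 - t j) \<le> exp (C * t j)" for j
  proof -
    have "1 / (1 - t j) = 1 + t j / (1 - t j)"
      using t(2)[of j] t(3) by (simp add: field_simps)
    also have "\<dots> \<le> 1 + t j / (1 - r)"
      using t(1,2)[of j] t(3) by (intro add_left_mono divide_left_mono) auto
    also have "\<dots> \<le> exp (C * t j)"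
      using exp_ge_add_one_self[of "C * t j"] by (simp add: C_def)
    finally show ?thesis .
  qed
  have bound: "1 / V j \<le> 1 / V 0 * exp (C * (\<Sum>i<j. t i))" for j
  proof (induction j)
    case (Suc j)
    have "1 / V (Suc j) \<le> (1 / V 0 * exp (C * (\<Sum>i<j. t i))) * exp (C * t j)"
      unfolding step using V(1)[of 0] t(2)[of j] t(3) by (intro mult_mono Suc upper) auto
    then show ?case by (simp add: exp_add distrib_left mult.assoc)
  qed simp
  have "1 / V j \<le> 1 / V 0 * exp (C * suminf t)" for j
  proof -
    have "C * (\<Sum>i<j. t i) \<le> C * suminf t"
      using t(1) by (intro mult_left_mono sum_le_suminf sm C) auto
    then have "1 / V 0 * exp (C * (\<Sum>i<j. t i)) \<le> 1 / V 0 * exp (C * suminf t)"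
      using V(1)[of 0] by (intro mult_left_mono) auto
    then show ?thesis using bound[of j] by linarith
  qed
  moreover have "incseq (\<lambda>j. 1 / V j)"
  proof (rule incseq_SucI)
    fix j show "1 / V j \<le> 1 / V (Suc j)"
      unfolding step using mult_left_mono[OF lower[of j], of "1 / V j"] V(1)[of j] by simp
  qed
  ultimately obtain L where "(\<lambda>j. 1 / V j) \<longlonglongrightarrow> L"
    using incseq_convergent by blast
  then show ?thesis by (rule convergentI)
qed

section \<open>Passage to arc length and conclusion\<close>

lemma star_measurable [measurable]: "star n p \<in> borel_measurable borel"
proof -
  have poly: "poly p \<in> borel_measurable borel"
    by (intro borel_measurable_continuous_onI continuous_intros)
  have cnj: "cnj \<in> borel_measurable borel"
    by (intro borel_measurable_continuous_onI continuous_intros)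
  note [measurable] = poly cnj
  show ?thesis
    unfolding star_def by measurable
qed

lemma AE_arc_length:
  assumes P: "Measurable.pred borel P"
    and ae: "AE x in lborel. x \<in> {0..2 * pi} \<longrightarrow> P (cis x)"
  shows "AE z in arc_length. P z"
proof -
  have "cis \<in> borel_measurable borel"
    by (intro borel_measurable_continuous_onI) (simp add: continuous_on_cis)
  then have cis: "cis \<in> measurable (restrict_space lborel {0..<2 * pi}) borel"
    by (intro measurable_restrict_space1) simp
  have "AE x in restrict_space lborel {0..<2 * pi}. P (cis x)"
    using ae by (subst AE_restrict_space_iff) (auto elim: eventually_mono)
  then show ?thesis
    unfolding arc_length_def using P cis by (subst AE_distr_iff) auto
qed

theorem corollary1p5:
  fixes q :: real
    and n :: "nat \<Rightarrow> nat"
    and \<delta> :: "nat \<Rightarrow> complex"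
    and \<sigma> :: "complex measure"
  assumes "q \<ge> 2"
    and "\<And>j. n j \<ge> 1"
    and "n 0 = 1"
    and "\<And>j. real (n (Suc j)) / real (n j) \<ge> q"
    and "summable (\<lambda>j. (cmod (\<delta> j))\<^sup>2)"
    and "(SUP j. cmod (\<delta> j)) < 1"
    and "circle_prob \<sigma>"
    and "infinite (circle_support \<sigma>)"
    and "\<And>j. j \<ge> 1 \<Longrightarrow> recurrence_coeff \<sigma> (n j) = \<delta> j"
    and "\<And>k. k \<notin> n ` {1..} \<Longrightarrow> recurrence_coeff \<sigma> k = 0"
  shows "AE z in arc_length.
           convergent (\<lambda>k. star k (orthonormal_OP \<sigma> k) z)
         \<and> convergent (\<lambda>k. star k (monic_OP \<sigma> k) z)"
proof -
  interpret circle_measure \<sigma> using assms(7,8) by unfold_locales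
  have lac: "2 * n j \<le> n (Suc j)" for j
  proof -
    have "0 < real (n j)" using assms(2)[of j] by simp
    then have "q * real (n j) \<le> real (n (Suc j))"
      using assms(4)[of j] by (simp add: pos_le_divide_eq)
    moreover have "2 * real (n j) \<le> q * real (n j)"
      using assms(1) by (intro mult_right_mono) auto
    ultimately show ?thesis by linarith
  qed
  have strict: "strict_mono n"
  proof (rule strict_monoI_Suc)
    show "n j < n (Suc j)" for j using lac[of j] assms(2)[of j] by linarith
  qed
  interpret lacunary_reflection n \<delta>
    using assms(3,5) lac by unfold_locales
  define A where "A k z = star k (monic_OP \<sigma> k) z" for k z
  define V where "V k = normsq (monic_OP \<sigma> k)" for k
  have V_pos: "0 < V k" for k
    unfolding V_def by (rule normsq_pos[OF monic_OP_nonzero])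
  have A_const: "A (Suc k) z = A k z" if "cmod z = 1" "k \<notin> n ` {1..}" for k z
    unfolding A_def star_monic_OP_Suc[OF that(1)] assms(10)[OF that(2)] by simp
  have V_const: "V (Suc k) = V k" if "k \<notin> n ` {1..}" for k
    unfolding V_def normsq_monic_OP_Suc assms(10)[OF that] by simp

  \<comment> \<open>A real supremum bounds its terms only when the set is bounded above, which here
    follows from square-summability.\<close>
  have "bdd_above (range (\<lambda>j. cmod (\<delta> j)))"
  proof (rule bdd_aboveI2)
    fix j
    have "(cmod (\<delta> j))\<^sup>2 \<le> (\<Sum>j. (cmod (\<delta> j))\<^sup>2)"
      using sum_le_suminf[OF assms(5), of "{j}"] by simp
    then show "cmod (\<delta> j) \<le> sqrt (\<Sum>j. (cmod (\<delta> j))\<^sup>2)" by (rule real_le_rsqrt)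
  qed
  then have \<delta>_le: "cmod (\<delta> j) \<le> (SUP j. cmod (\<delta> j))" for j
    by (rule cSUP_upper2[OF _ UNIV_I order_refl])
  have "convergent (\<lambda>j. 1 / V (Suc (n j)))"
  proof (rule convergent_inverse_products[where t = "\<lambda>j. (cmod (\<delta> (Suc j)))\<^sup>2" and r = "(SUP j. cmod (\<delta> j))\<^sup>2"])
    show "V (Suc (n (Suc j))) = (1 - (cmod (\<delta> (Suc j)))\<^sup>2) * V (Suc (n j))" for j
    proof -
      have "n j < n (Suc j)" using strict by (simp add: strict_mono_Suc_iff)
      then have "V (n (Suc j)) = V (Suc (n j))"
        by (intro lacunary_step_constant[where X = V, OF strict V_const]) auto
      then show ?thesis
        unfolding V_def using normsq_monic_OP_Suc[of "n (Suc j)"] assms(9)[of "Suc j"] by simp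
    qed
    have "0 \<le> (SUP j. cmod (\<delta> j))" using \<delta>_le[of 0] norm_ge_zero[of "\<delta> 0"] by linarith
    then show "(SUP j. cmod (\<delta> j))\<^sup>2 < 1"
      using assms(6) by (simp add: power_less_one_iff)
    show "summable (\<lambda>j. (cmod (\<delta> (Suc j)))\<^sup>2)"
      using assms(5) by (subst summable_Suc_iff)
  qed (use V_pos \<delta>_le in \<open>auto intro!: power_mono\<close>)
  then have "convergent (\<lambda>k. 1 / V k)"
    by (intro lacunary_step_convergent[OF strict, where X = "\<lambda>k. 1 / V k"]) (simp_all add: V_const)
  then obtain L where "(\<lambda>k. 1 / V k) \<longlonglongrightarrow> L" by (auto simp: convergent_def)
  then have "(\<lambda>k. complex_of_real (sqrt (1 / V k))) \<longlonglongrightarrow> complex_of_real (sqrt L)"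
    by (intro tendsto_of_real tendsto_real_sqrt)
  then have norm_conv: "convergent (\<lambda>k. complex_of_real (1 / sqrt (V k)))"
    by (auto simp: real_sqrt_divide intro: convergentI)

  have "AE x in lborel. x \<in> {0..2 * pi} \<longrightarrow> convergent (\<lambda>j. A (Suc (n j)) (cis x))"
  proof (rule reflection_recurrence_converges[where b = "\<lambda>j x. A (Suc (n j)) (cis x)"])
    fix x
    \<comment> \<open>Nontrivial steps occur only at indices above 1. The steps at 0 and 1 are
      therefore trivial, and the polynomial of index \<open>Suc (n 0) = 2\<close> still has reversal
      1 on the circle.\<close>
    have "1 < n j" if "1 \<le> j" for j
      using strict_mono_less[OF strict, of 0 j] that assms(3) by simp
    then have "0 \<notin> n ` {1..}" "1 \<notin> n ` {1..}"
      by (metis imageE atLeast_iff less_irrefl less_zeroE)+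
    then have "A (Suc (n 0)) (cis x) = A 0 (cis x)"
      using A_const[of "cis x" 0] A_const[of "cis x" 1] assms(3) by simp
    then show "A (Suc (n 0)) (cis x) = 1"
      by (simp add: A_def monic_OP_0 star_def)
    fix j
    have "n j < n (Suc j)" using strict by (simp add: strict_mono_Suc_iff)
    then have eq: "A (n (Suc j)) (cis x) = A (Suc (n j)) (cis x)"
      by (intro lacunary_step_constant[OF strict, where X = "\<lambda>k. A k (cis x)"] A_const) auto
    have "recurrence_coeff \<sigma> (n (Suc j)) = \<delta> (Suc j)"
      using assms(9)[of "Suc j"] by simp
    then have "A (Suc (n (Suc j))) (cis x) = A (n (Suc j)) (cis x)
        - \<delta> (Suc j) * cis x ^ Suc (n (Suc j)) * cnj (A (n (Suc j)) (cis x))"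
      unfolding A_def by (simp only: star_monic_OP_Suc[OF norm_cis])
    then show "A (Suc (n (Suc j))) (cis x) = A (Suc (n j)) (cis x)
        - \<delta> (Suc j) * cis (real (Suc (n (Suc j))) * x) * cnj (A (Suc (n j)) (cis x))"
      by (simp only: eq Complex.DeMoivre)
  qed
  then have "AE x in lborel. x \<in> {0..2 * pi} \<longrightarrow>
      convergent (\<lambda>k. star k (orthonormal_OP \<sigma> k) (cis x)) \<and> convergent (\<lambda>k. star k (monic_OP \<sigma> k) (cis x))"
  proof eventually_elim
    case (elim x)
    show ?case
    proof
      assume "x \<in> {0..2 * pi}"
      with elim have "convergent (\<lambda>j. A (Suc (n j)) (cis x))" by blast
      then have conv: "convergent (\<lambda>k. A k (cis x))"
        by (rule lacunary_step_convergent[OF strict, rotated]) (rule A_const, simp_all)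
      show "convergent (\<lambda>k. star k (orthonormal_OP \<sigma> k) (cis x)) \<and> convergent (\<lambda>k. star k (monic_OP \<sigma> k) (cis x))"
        using convergent_mult[OF norm_conv conv] conv by (simp only: star_orthonormal_OP A_def V_def)
    qed
  qed
  then show ?thesis
    \<comment> \<open>\<open>AE_arc_length\<close> asks for a measurable predicate; in Cauchy form,
      convergence is measurable.\<close>
    by (rule AE_arc_length[rotated]) (unfold Cauchy_convergent_iff[symmetric], measurable)
qed

end
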